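(* Let $n\ge 4$ be an integer and let $V=\mathbb{F}_2^n$. Let $h:\mathcal{C}(n,2)_2\to\mathcal{G}_2(V)$ be the map which leaves fixed every element of $\mathcal{A}\cup\mathcal{B}$ and sends every $X\in\mathcal{C}$ to $X^c$ (all defined in the context). If an isomorphism $f$ of the graph $\Gamma(n,2)_2$ to a (not necessarily induced) subgraph of the Grassmann graph $\Gamma_2(V)$ cannot be extended to an automorphism of $\Gamma_2(V)$, then $f=gh$ (that is, $f=g\circ h$) for a certain automorphism $g$ of $\Gamma_2(V)$.
   Context: Let $n\ge 4$, let $\mathbb{F}_2$ be the field of two elements and let $V=\mathbb{F}_2^n$. $\mathcal{G}_k(V)$ denotes the set of $k$-dimensional subspaces of $V$. Two distinct $2$-dimensional subspaces of $V$ are adjacent if their intersection is $1$-dimensional. The Grassmann graph $\Gamma_2(V)$ is the simple graph with vertex set $\mathcal{G}_2(V)$ whose edges join adjacent subspaces. Let $C_i$ be the hyperplane of $V$ formed by all vectors whose $i$-th coordinate is $0$. $\mathcal{C}(n,2)_2$ is the set of non-degenerate linear $[n,2]_2$ codes, i.e. of all $2$-dimensional subspaces of $V$ not contained in any $C_i$, $i\in\{1,\dots,n\}$. $\Gamma(n,2)_2$ is the subgraph of $\Gamma_2(V)$ induced by $\mathcal{C}(n,2)_2$. An isomorphism of $\Gamma(n,2)_2$ to a (not necessarily induced) subgraph of $\Gamma_2(V)$ is the same as an injective map $f:\mathcal{C}(n,2)_2\to\mathcal{G}_2(V)$ sending adjacent elements to adjacent elements. Such $f$ can be extended to an automorphism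 of $\Gamma_2(V)$ if it is the restriction to $\mathcal{C}(n,2)_2$ of some automorphism of $\Gamma_2(V)$. Let $Q$ be the $1$-dimensional subspace of $V$ containing $(1,\dots,1)$. For every non-empty proper subset $I\subset\{1,\dots,n\}$ let $P_I$ be the $1$-dimensional subspace containing the vector whose $i$-th coordinate is $1$ if $i\in I$ and $0$ if $i\notin I$; put $I^c=\{1,\dots,n\}\setminus I$ and $P^I=P_{I^c}$; write $P^i=P^{\{i\}}$. Let $H$ be the hyperplane of $V$ spanned by $P^1,\dots,P^{n-1}$. One has $Q\not\subset H$, and for every non-empty proper $I\subset\{1,\dots,n\}$ precisely one of $P_I,P^I$ is contained in $H$. Then $\mathcal{C}(n,2)_2$ is decomposed into three subsets: - $\mathcal{A}$ is the set of all elements of $\mathcal{C}(n,2)_2$ containing $Q$; - $\mathcal{B}$ is the set of all elements of $\mathcal{C}(n,2)_2$ contained in $H$; - $\mathcal{C}=\mathcal{C}(n,2)_2\setminus(\mathcal{A}\cup\mathcal{B})$. For $X\in\mathcal{C}$, the intersection $X\cap H$ is $1$-dimensional; if $P_I,P_J$ are the two $1$-dimensional subspaces of $X$ not contained in $H$, then $X^c$ denotes the $2$-dimensional subspace $P^I+P^J$. *)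

theory Defs
  imports "HOL-Library.Z2" "HOL-Analysis.Cartesian_Space"
begin

(* A graph is a pair of a vertex set and a set of edges, each edge {x, y} being an unordered pair. *)

type_synonym 'a graph = "'a set \<times> 'a set set"

abbreviation verts :: "'a graph \<Rightarrow> 'a set" where
  "verts \<equiv> fst"

abbreviation edges :: "'a graph \<Rightarrow> 'a set set" where
  "edges \<equiv> snd"

definition subgraph :: "'a graph \<Rightarrow> 'a graph \<Rightarrow> bool" where
  "subgraph G' G \<longleftrightarrow>
     verts G' \<subseteq> verts G \<and> edges G' \<subseteq> edges G \<and> (\<forall>e \<in> edges G'. e \<subseteq> verts G')"

definition induced_subgraph :: "'a graph \<Rightarrow> 'a set \<Rightarrow> 'a graph" where
  "induced_subgraph G S = (S, {e \<in> edges G. e \<subseteq> S})"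

(* Only the values of f on verts G matter. *)
definition graph_iso :: "('a \<Rightarrow> 'b) \<Rightarrow> 'a graph \<Rightarrow> 'b graph \<Rightarrow> bool" where
  "graph_iso f G G' \<longleftrightarrow>
     bij_betw f (verts G) (verts G') \<and>
     (\<forall>x \<in> verts G. \<forall>y \<in> verts G. {x, y} \<in> edges G \<longleftrightarrow> {f x, f y} \<in> edges G')"

abbreviation graph_aut :: "('a \<Rightarrow> 'a) \<Rightarrow> 'a graph \<Rightarrow> bool" where
  "graph_aut g G \<equiv> graph_iso g G G"

(* V = F_2^n is the type bit ^ 'n with n = CARD('n); vec.subspace, vec.dim and vec.span are the
   linear-algebra notions over the coefficient field. *)

definition Grass :: "nat \<Rightarrow> (bit ^ 'n) set set" where
  "Grass k = {X. vec.subspace X \<and> vec.dim X = k}"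

definition adjacent :: "(bit ^ 'n) set \<Rightarrow> (bit ^ 'n) set \<Rightarrow> bool" where
  "adjacent X Y \<longleftrightarrow> X \<noteq> Y \<and> vec.dim (X \<inter> Y) = 1"

definition grassmann_graph :: "(bit ^ 'n) set graph" where
  "grassmann_graph = (Grass 2, {{X, Y} | X Y. X \<in> Grass 2 \<and> Y \<in> Grass 2 \<and> adjacent X Y})"

definition coord_hyperplane :: "'n \<Rightarrow> (bit ^ 'n) set" where
  "coord_hyperplane i = {x. x $ i = 0}"

definition codes :: "(bit ^ 'n) set set" where
  "codes = {X \<in> Grass 2. \<forall>i. \<not> X \<subseteq> coord_hyperplane i}"

definition code_graph :: "(bit ^ 'n) set graph" where
  "code_graph = induced_subgraph grassmann_graph codes"

definition ones_line :: "(bit ^ 'n) set" where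
  "ones_line = vec.span {\<chi> i. 1}"

(* P_I and P^I; both are 1-dimensional only if I is non-empty and proper. *)

definition line_of :: "'n set \<Rightarrow> (bit ^ 'n) set" where
  "line_of I = vec.span {\<chi> i. if i \<in> I then 1 else 0}"

definition coline_of :: "'n set \<Rightarrow> (bit ^ 'n) set" where
  "coline_of I = line_of (- I)"

(* The hyperplane H, and everything built from it, singles out one coordinate (the last one, for
   coordinates 1, ..., n).  Here it is an arbitrary m :: 'n. *)

definition hyp :: "'n \<Rightarrow> (bit ^ 'n) set" where
  "hyp m = vec.span (\<Union>i \<in> - {m}. coline_of {i})"

definition codesA :: "(bit ^ 'n) set set" where
  "codesA = {X \<in> codes. ones_line \<subseteq> X}"

definition codesB :: "'n \<Rightarrow> (bit ^ 'n) set set" where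
  "codesB m = {X \<in> codes. X \<subseteq> hyp m}"

definition codesC :: "'n \<Rightarrow> (bit ^ 'n) set set" where
  "codesC m = codes - (codesA \<union> codesB m)"

definition off_hyp :: "'n \<Rightarrow> (bit ^ 'n) set \<Rightarrow> 'n set set" where
  "off_hyp m X = {I. I \<noteq> {} \<and> I \<noteq> UNIV \<and> line_of I \<subseteq> X \<and> \<not> line_of I \<subseteq> hyp m}"

(* The code X^c.  For X in codesC m the set off_hyp m X has exactly two elements I and J, and then
   the span below is the sum P^I + P^J; see code_compl_eq. *)

definition code_compl :: "'n \<Rightarrow> (bit ^ 'n) set \<Rightarrow> (bit ^ 'n) set" where
  "code_compl m X = vec.span (\<Union>I \<in> off_hyp m X. coline_of I)"

lemma code_compl_eq:
  fixes m :: "'n::finite"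
  assumes "off_hyp m X = {I, J}"
  shows "code_compl m X = {x + y | x y. x \<in> coline_of I \<and> y \<in> coline_of J}"
proof -
  have "vec.span (coline_of K) = coline_of K" for K :: "'n set"
    unfolding coline_of_def line_of_def by (rule vec.span_span)
  then show ?thesis
    unfolding code_compl_def assms by (simp add: vec.span_Un del: vec.span_eq_iff)
qed

definition h_map :: "'n \<Rightarrow> (bit ^ 'n) set \<Rightarrow> (bit ^ 'n) set" where
  "h_map m X = (if X \<in> codesC m then code_compl m X else X)"

end

theory Submission
  imports Defs
begin

text \<open>Let \<open>1\<close> be the all-ones vector. The codes through \<open>1\<close> are all the 2-dimensional subspaces through
\<open>1\<close> and form a clique, so their images share a vector or lie in a 3-dimensional subspace. By counting, the
latter occurs only for \<open>n = 4\<close>, where the orthogonality duality leads back to the former. After a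
transvection the shared vector is \<open>1\<close>. A code not through \<open>1\<close> meets three codes through \<open>1\<close>, so \<open>f\<close>
acts on the points of \<open>V / 1\<close> additively on vectors with disjoint supports, hence linearly, and after
a linear automorphism \<open>f\<close> fixes all codes through \<open>1\<close>. Then there is a linear functional \<open>l\<close> such that \<open>f\<close>
is induced by the shear \<open>x \<mapsto> x + l x 1\<close> on the remaining codes. If \<open>l 1 = 0\<close>, the shear is invertible
and extends \<open>f\<close>. If \<open>l 1 = 1\<close>, it is the projection along \<open>1\<close> onto the kernel of \<open>l\<close>; as \<open>h\<close> is the
projection along \<open>1\<close> onto \<open>H\<close>, the two differ by an invertible shear.\<close>

section \<open>Two-dimensional subspaces over the field of two elements\<close>

text \<open>Makes \<open>bit ^ 'n\<close> finite: injective linear self-maps of V are then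
  bijective, and vectors and planes can be counted.\<close>

instance bit :: finite
proof
  have "(UNIV :: bit set) = {0, 1}" by (auto intro: bit_not_zero_iff[THEN iffD1])
  then show "finite (UNIV :: bit set)" by (metis finite.emptyI finite.insertI)
qed

lemma CARD_bit [simp]: "CARD(bit) = 2"
proof -
  have "(UNIV :: bit set) = {0, 1}" by (auto intro: bit_not_zero_iff[THEN iffD1])
  then show ?thesis by (metis card_2_iff zero_neq_one)
qed

lemma bit_add_self [simp]: "b + b = (0 :: bit)"
  by (cases b) auto

(* These rules turn sums and products of bits into Boolean operations and block ring reasoning. *)
declare add_bit_eq_xor [simp del] mult_bit_eq_and [simp del]

lemma vec_bit_add_self [simp]: "x + x = (0 :: bit ^ 'n)"
  by (simp add: vec_eq_iff)

lemma vec_bit_two_eq_0 [simp]: "(2 :: bit ^ 'n) = 0"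
  by (simp add: vec_eq_iff)

lemma vec_bit_add_left_self [simp]: "x + (x + y) = (y :: bit ^ 'n)"
  by (simp flip: add.assoc)

lemma vec_bit_add_eq_0_iff [simp]: "x + y = 0 \<longleftrightarrow> x = (y :: bit ^ 'n)"
  by (metis add.right_neutral vec_bit_add_left_self vec_bit_add_self)

lemma vec_bit_one_neq_zero [simp]: "(1 :: bit ^ 'n) \<noteq> 0" "(0 :: bit ^ 'n) \<noteq> 1"
  by (auto simp: vec_eq_iff)

lemma chi_one_eq: "(\<chi> i. 1) = (1 :: bit ^ 'n)"
  by (simp add: vec_eq_iff)

lemma vec_bit_neq_zeroE:
  assumes "x \<noteq> (0 :: bit ^ 'n)"
  obtains i where "x $ i = 1"
  using assms by (auto simp: vec_eq_iff)

lemma vec_bit_neq_oneE: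
  assumes "x \<noteq> (1 :: bit ^ 'n)"
  obtains i where "x $ i = 0"
  using assms by (auto simp: vec_eq_iff)

lemma vec_bit_subspace_iff:
  "vec.subspace (S :: (bit ^ 'n::finite) set) \<longleftrightarrow> 0 \<in> S \<and> (\<forall>x \<in> S. \<forall>y \<in> S. x + y \<in> S)"
proof
  assume r: "0 \<in> S \<and> (\<forall>x \<in> S. \<forall>y \<in> S. x + y \<in> S)"
  show "vec.subspace S"
  proof (rule vec.subspaceI)
    fix c :: bit and x assume "x \<in> S"
    then show "c *s x \<in> S" using r by (cases c) auto
  qed (use r in auto)
qed (auto simp: vec.subspace_0 vec.subspace_add)

text \<open>Listing the vectors turns membership into a case split. Independence is not built in:
  \<open>span2 a a\<close> is just \<open>{0, a}\<close>.\<close>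

definition span2 :: "bit ^ 'n \<Rightarrow> bit ^ 'n \<Rightarrow> (bit ^ 'n) set" where
  "span2 a b = {0, a, b, a + b}"

lemma subspace_span2: "vec.subspace (span2 a b :: (bit ^ 'n::finite) set)"
  by (auto simp: vec_bit_subspace_iff span2_def ac_simps)

lemma span_pair_eq_span2: "vec.span {a, b} = (span2 a b :: (bit ^ 'n::finite) set)"
proof
  show "vec.span {a, b} \<subseteq> span2 a b"
    by (rule vec.span_minimal) (auto simp: span2_def subspace_span2[unfolded span2_def])
  show "span2 a b \<subseteq> vec.span {a, b}"
    by (auto simp: span2_def vec.span_zero vec.span_base vec.span_add)
qed

lemma span_singleton_eq: "vec.span {a} = {0, a :: bit ^ 'n::finite}"
  using span_pair_eq_span2[of a a] by (auto simp: span2_def)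

text \<open>The only nonzero scalar is 1, so two distinct nonzero vectors are already
  independent.\<close>

lemma Grass2_iff:
  "(X :: (bit ^ 'n::finite) set) \<in> Grass 2 \<longleftrightarrow> (\<exists>a b. a \<noteq> 0 \<and> b \<noteq> 0 \<and> a \<noteq> b \<and> X = span2 a b)"
proof
  assume "X \<in> Grass 2"
  then have X: "vec.subspace X" "vec.dim X = 2" by (auto simp: Grass_def)
  obtain B where B: "B \<subseteq> X" "vec.independent B" "X \<subseteq> vec.span B" "card B = vec.dim X"
    using vec.basis_exists by metis
  then obtain a b where ab: "B = {a, b}" "a \<noteq> b"
    using X(2) by (auto simp: card_2_iff)
  have "0 \<notin> B" using B(2) vec.dependent_zero by blast
  moreover have "X = vec.span B"
    using B X(1) by (simp add: subset_antisym vec.span_minimal)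
  ultimately show "\<exists>a b. a \<noteq> 0 \<and> b \<noteq> 0 \<and> a \<noteq> b \<and> X = span2 a b"
    using ab span_pair_eq_span2 by (intro exI[of _ a] exI[of _ b]) auto
next
  assume "\<exists>a b. a \<noteq> 0 \<and> b \<noteq> 0 \<and> a \<noteq> b \<and> X = span2 a b"
  then obtain a b where ab: "a \<noteq> 0" "b \<noteq> 0" "a \<noteq> b" "X = span2 a b" by auto
  have "a \<notin> vec.span {b}" using ab by (auto simp: span_singleton_eq)
  then have "vec.independent {a, b}"
    using ab by (intro vec.independent_insertI) (auto simp: vec.independent_empty)
  then have "vec.dim (vec.span {a, b}) = 2"
    using ab(3) by (simp add: vec.dim_eq_card_independent)
  then show "X \<in> Grass 2"
    using ab subspace_span2 by (auto simp: Grass_def span_pair_eq_span2)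
qed

lemma span2_in_Grass:
  "a \<noteq> 0 \<Longrightarrow> b \<noteq> 0 \<Longrightarrow> a \<noteq> b \<Longrightarrow> span2 a b \<in> (Grass 2 :: (bit ^ 'n::finite) set set)"
  by (auto simp: Grass2_iff)

lemma Grass2_zero: "(X :: (bit ^ 'n::finite) set) \<in> Grass 2 \<Longrightarrow> 0 \<in> X"
  by (auto simp: Grass_def vec.subspace_0)

lemma Grass2_add:
  "(X :: (bit ^ 'n::finite) set) \<in> Grass 2 \<Longrightarrow> x \<in> X \<Longrightarrow> y \<in> X \<Longrightarrow> x + y \<in> X"
  by (auto simp: Grass_def vec.subspace_add)

lemma Grass2_eq_span2:
  assumes "(X :: (bit ^ 'n::finite) set) \<in> Grass 2" "x \<in> X" "y \<in> X" "x \<noteq> 0" "y \<noteq> 0" "x \<noteq> y"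
  shows "X = span2 x y"
proof -
  obtain a b where "X = span2 a b" using assms(1) by (auto simp: Grass2_iff)
  then show ?thesis using assms(2-)
    by (auto simp: span2_def ac_simps)
qed

lemma Grass2_cong:
  assumes "(X :: (bit ^ 'n::finite) set) \<in> Grass 2" "Y \<in> Grass 2"
    and "x \<in> X" "y \<in> X" "x \<in> Y" "y \<in> Y" "x \<noteq> 0" "y \<noteq> 0" "x \<noteq> y"
  shows "X = Y"
  using assms Grass2_eq_span2 by metis

lemma Grass2_obtain:
  assumes "(X :: (bit ^ 'n::finite) set) \<in> Grass 2" "x \<in> X" "x \<noteq> 0"
  obtains y where "y \<in> X" "y \<noteq> 0" "y \<noteq> x" "X = span2 x y"
proof -
  obtain a b where ab: "X = span2 a b" "a \<noteq> 0" "b \<noteq> 0" "a \<noteq> b"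
    using assms(1) by (auto simp: Grass2_iff)
  then obtain y where "y \<in> X" "y \<noteq> 0" "y \<noteq> x" 
    by (cases "x = a") (auto simp: span2_def)
  then show thesis using that Grass2_eq_span2 assms by metis
qed

text \<open>Distinct planes sharing a nonzero \<open>v\<close> meet exactly in
  \<open>{0, v}\<close>, since a second common nonzero vector would make them equal.\<close>

lemma adjacent_iff:
  assumes X: "(X :: (bit ^ 'n::finite) set) \<in> Grass 2" and Y: "Y \<in> Grass 2"
  shows "adjacent X Y \<longleftrightarrow> X \<noteq> Y \<and> (\<exists>v. v \<noteq> 0 \<and> v \<in> X \<and> v \<in> Y)"
proof (cases "X = Y")
  case False
  have 1: "0 \<in> X \<inter> Y" using X Y Grass2_zero by auto
  show ?thesis
  proof (cases "\<exists>v. v \<noteq> 0 \<and> v \<in> X \<and> v \<in> Y")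
    case True
    then obtain v where v: "v \<noteq> 0" "v \<in> X" "v \<in> Y" by auto
    have "X \<inter> Y = {0, v}"
      using 1 v False Grass2_cong[OF X Y] by blast
    then have "X \<inter> Y = vec.span {v}" by (simp add: span_singleton_eq)
    moreover have "vec.dim (vec.span {v}) = 1"
      using v(1) by (simp add: vec.dim_eq_card_independent)
    ultimately show ?thesis using True False by (auto simp: adjacent_def)
  next
    case no: False
    then have eq: "X \<inter> Y = {0}" using 1 by auto
    have "vec.dim (X \<inter> Y) \<noteq> 1" unfolding eq by simp
    then show ?thesis using no unfolding adjacent_def by blast
  qed
qed (simp add: adjacent_def)

lemma edge_grassmann_iff:
  "{X, Y} \<in> edges grassmann_graph \<longleftrightarrow>
    X \<in> Grass 2 \<and> Y \<in> Grass 2 \<and> X \<noteq> Y \<and> (\<exists>v. v \<noteq> 0 \<and> v \<in> X \<and> v \<in> (Y :: (bit ^ 'n::finite) set))"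
proof -
  have "{X, Y} \<in> edges grassmann_graph \<longleftrightarrow>
    X \<in> Grass 2 \<and> Y \<in> Grass 2 \<and> (adjacent X Y \<or> adjacent Y X)"
    by (auto simp: grassmann_graph_def doubleton_eq_iff)
  then show ?thesis using adjacent_iff by metis
qed

lemma verts_grassmann [simp]: "verts grassmann_graph = Grass 2"
  by (simp add: grassmann_graph_def)

section \<open>Automorphisms and embeddings\<close>

lemma graph_aut_comp:
  assumes "graph_aut g G" "graph_aut g' G"
  shows "graph_aut (g \<circ> g') G"
proof -
  have "bij_betw (g \<circ> g') (verts G) (verts G)"
    using assms bij_betw_trans by (auto simp: graph_iso_def)
  moreover have "g' x \<in> verts G" if "x \<in> verts G" for x
    using assms(2) that by (auto simp: graph_iso_def bij_betw_def)
  ultimately show ?thesis using assms by (auto simp: graph_iso_def)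
qed

lemma graph_aut_inv_into:
  assumes "graph_aut g G"
  shows "graph_aut (inv_into (verts G) g) G"
proof -
  let ?h = "inv_into (verts G) g"
  have bij: "bij_betw g (verts G) (verts G)" using assms by (simp add: graph_iso_def)
  have "{x, y} \<in> edges G \<longleftrightarrow> {?h x, ?h y} \<in> edges G" if "x \<in> verts G" "y \<in> verts G" for x y
  proof -
    have "?h x \<in> verts G" "?h y \<in> verts G"
      using that bij_betwE[OF bij_betw_inv_into[OF bij]] by auto
    moreover have "g (?h x) = x" "g (?h y) = y"
      using that bij by (simp_all add: bij_betw_inv_into_right)
    ultimately show ?thesis using assms by (metis graph_iso_def)
  qed
  then show ?thesis using bij_betw_inv_into[OF bij] by (simp add: graph_iso_def)
qed

lemma image_span2:
  assumes "\<And>x y. F (x + y) = F x + F (y :: bit ^ 'n)"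
  shows "F ` span2 a b = span2 (F a) (F b)"
proof -
  have "F 0 = 0" using assms[of 0 0] by simp
  then show ?thesis by (simp add: span2_def assms)
qed

lemma image_in_Grass2:
  fixes F :: "bit ^ 'n::finite \<Rightarrow> bit ^ 'n"
  assumes add: "\<And>x y. F (x + y) = F x + F y" and "inj F" and "X \<in> Grass 2"
  shows "F ` X \<in> Grass 2"
proof -
  obtain a b where "a \<noteq> 0" "b \<noteq> 0" "a \<noteq> b" "X = span2 a b"
    using assms(3) by (auto simp: Grass2_iff)
  moreover have "F 0 = 0" using add[of 0 0] by simp
  moreover have "F x = F y \<longleftrightarrow> x = y" for x y using \<open>inj F\<close> by (rule inj_eq)
  ultimately have "F a \<noteq> 0" "F b \<noteq> 0" "F a \<noteq> F b" by metis+
  then show ?thesis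
    unfolding \<open>X = span2 a b\<close> image_span2[of F, OF add] by (rule span2_in_Grass)
qed

text \<open>Additivity is linearity over a prime field. By finiteness \<open>F\<close> is bijective
  with additive inverse, so both maps send planes to planes.\<close>

lemma graph_aut_image:
  fixes F :: "bit ^ 'n::finite \<Rightarrow> bit ^ 'n"
  assumes add: "\<And>x y. F (x + y) = F x + F y" and inj: "inj F"
  shows "graph_aut (image F) grassmann_graph"
proof -
  have bij: "bij F" using inj by (simp add: bij_betw_def finite_UNIV_inj_surj[OF finite])
  then have F: "F (inv F x) = x" "inv F (F x) = x" for x
    by (simp_all add: bij_betw_def surj_f_inv_f)
  have add': "inv F (x + y) = inv F x + inv F y" for x y
    by (metis F add)
  have inj': "inj (inv F)" using bij by (simp add: bij_imp_bij_inv bij_is_inj)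
  have "bij_betw (image F) (Grass 2) (Grass 2)"
  proof (rule bij_betwI[where g = "image (inv F)"])
    show "(`) F \<in> Grass 2 \<rightarrow> Grass 2" "(`) (inv F) \<in> Grass 2 \<rightarrow> Grass 2"
      using image_in_Grass2[OF add inj] image_in_Grass2[OF add' inj'] by auto
  qed (simp_all add: image_image F)
  moreover have "{X, Y} \<in> edges grassmann_graph \<longleftrightarrow> {F ` X, F ` Y} \<in> edges grassmann_graph"
    if "X \<in> Grass 2" "Y \<in> Grass 2" for X Y
  proof -
    have "F ` X \<in> Grass 2" "F ` Y \<in> Grass 2"
      using image_in_Grass2[OF add inj] that by auto
    moreover have "F ` X = F ` Y \<longleftrightarrow> X = Y" using inj by (simp add: inj_image_eq_iff)
    moreover have "(\<exists>v. v \<noteq> 0 \<and> v \<in> F ` X \<and> v \<in> F ` Y) \<longleftrightarrow> (\<exists>v. v \<noteq> 0 \<and> v \<in> X \<and> v \<in> Y)"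
    proof -
      have "F 0 = 0" using add[of 0 0] by simp
      then have "F v = 0 \<longleftrightarrow> v = 0" for v using inj by (metis injD)
      then show ?thesis using inj by (fastforce dest: injD)
    qed
    ultimately show ?thesis using that by (simp add: edge_grassmann_iff)
  qed
  ultimately show ?thesis by (simp add: graph_iso_def)
qed

text \<open>Expresses the hypothesis on \<open>f\<close> without naming the target subgraph, in a
  form stable under composition with automorphisms of the Grassmann graph.\<close>

definition code_emb :: "((bit ^ 'n) set \<Rightarrow> (bit ^ 'n) set) \<Rightarrow> bool" where
  "code_emb f \<longleftrightarrow> inj_on f codes \<and> f ` codes \<subseteq> Grass 2 \<and>
    (\<forall>X \<in> codes. \<forall>Y \<in> codes. adjacent X Y \<longrightarrow> adjacent (f X) (f Y))"

text \<open>The dichotomy behind the theorem: \<open>f\<close> extends, or \<open>f\<close> factors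
  through \<open>h\<close>. Composing \<open>f\<close> with an automorphism does not affect it, so
  \<open>f\<close> may be normalised.\<close>

definition aut_or_h :: "'n \<Rightarrow> ((bit ^ 'n) set \<Rightarrow> (bit ^ 'n) set) \<Rightarrow> bool" where
  "aut_or_h m f \<longleftrightarrow> (\<exists>g. graph_aut g grassmann_graph \<and>
    ((\<forall>X \<in> codes. f X = g X) \<or> (\<forall>X \<in> codes. f X = g (h_map m X))))"

lemma codes_subset_Grass: "codes \<subseteq> Grass 2"
  by (auto simp: codes_def)

lemma code_emb_if_graph_iso:
  fixes f :: "(bit ^ 'n::finite) set \<Rightarrow> (bit ^ 'n) set"
  assumes "subgraph G' grassmann_graph" "graph_iso f code_graph G'"
  shows "code_emb f"
  unfolding code_emb_def
proof (intro conjI ballI impI)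
  have v: "verts code_graph = (codes :: (bit ^ 'n) set set)"
    by (simp add: code_graph_def induced_subgraph_def)
  then have bij: "bij_betw f codes (verts G')" using assms(2) by (simp add: graph_iso_def)
  then show "inj_on f codes" by (simp add: bij_betw_def)
  show sub: "f ` codes \<subseteq> Grass 2"
    using bij assms(1) by (auto simp: bij_betw_def subgraph_def)
  fix X Y :: "(bit ^ 'n) set" assume XY: "X \<in> codes" "Y \<in> codes" "adjacent X Y"
  then have "{X, Y} \<in> edges grassmann_graph"
    using codes_subset_Grass adjacent_iff[of X Y] unfolding edge_grassmann_iff by blast
  then have "{X, Y} \<in> edges code_graph"
    using XY by (auto simp: code_graph_def induced_subgraph_def)
  then have "{f X, f Y} \<in> edges grassmann_graph"
    using XY v assms by (auto simp: graph_iso_def subgraph_def)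
  then show "adjacent (f X) (f Y)" by (auto simp: edge_grassmann_iff adjacent_iff)
qed

lemma code_emb_comp:
  fixes f :: "(bit ^ 'n::finite) set \<Rightarrow> (bit ^ 'n) set"
  assumes "code_emb f" "graph_aut g grassmann_graph"
  shows "code_emb (g \<circ> f)"
proof -
  have g: "bij_betw g (Grass 2) (Grass 2)"
    and adj: "\<And>X Y. X \<in> Grass 2 \<Longrightarrow> Y \<in> Grass 2 \<Longrightarrow>
      {X, Y} \<in> edges grassmann_graph \<longleftrightarrow> {g X, g Y} \<in> edges grassmann_graph"
    using assms(2) by (auto simp: graph_iso_def)
  have f: "inj_on f codes" "f ` codes \<subseteq> Grass 2"
    using assms(1) by (auto simp: code_emb_def)
  have "inj_on (g \<circ> f) codes"
    using f(1) inj_on_subset[OF bij_betw_imp_inj_on[OF g] f(2)] by (rule comp_inj_on)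
  moreover have gG: "g X \<in> Grass 2" if "X \<in> Grass 2" for X
    using g that by (auto simp: bij_betw_def)
  moreover have "adjacent (g (f X)) (g (f Y))" if "X \<in> codes" "Y \<in> codes" "adjacent X Y" for X Y
  proof -
    have "adjacent (f X) (f Y)" using assms(1) that by (auto simp: code_emb_def)
    moreover have "f X \<in> Grass 2" "f Y \<in> Grass 2" using f that by auto
    ultimately show ?thesis
      using adj[of "f X" "f Y"] gG by (auto simp: edge_grassmann_iff adjacent_iff)
  qed
  ultimately show ?thesis using f by (auto simp: code_emb_def)
qed

text \<open>Undoes a normalisation of \<open>f\<close> by applying the inverse automorphism, which
  cancels \<open>g\<close> because the values of \<open>f\<close> on codes are planes.\<close>

lemma aut_or_h_comp:
  fixes f :: "(bit ^ 'n::finite) set \<Rightarrow> (bit ^ 'n) set"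
  assumes "code_emb f" "graph_aut g grassmann_graph" "aut_or_h m (g \<circ> f)"
  shows "aut_or_h m f"
proof -
  let ?g' = "inv_into (Grass 2) g"
  have g': "graph_aut ?g' grassmann_graph" using graph_aut_inv_into[OF assms(2)] by simp
  have inv: "?g' (g (f X)) = f X" if "X \<in> codes" for X
  proof (rule inv_into_f_f)
    show "inj_on g (Grass 2)" using assms(2) by (simp add: graph_iso_def bij_betw_def)
    show "f X \<in> Grass 2" using assms(1) that by (auto simp: code_emb_def)
  qed
  obtain k where k: "graph_aut k grassmann_graph"
    "(\<forall>X \<in> codes. g (f X) = k X) \<or> (\<forall>X \<in> codes. g (f X) = k (h_map m X))"
    using assms(3) by (auto simp: aut_or_h_def)
  have "graph_aut (?g' \<circ> k) grassmann_graph" using graph_aut_comp[OF g' k(1)] .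
  moreover have "(\<forall>X \<in> codes. f X = (?g' \<circ> k) X) \<or> (\<forall>X \<in> codes. f X = (?g' \<circ> k) (h_map m X))"
    using k(2)
  proof
    assume "\<forall>X \<in> codes. g (f X) = k X"
    then show ?thesis using inv by (intro disjI1 ballI) (metis comp_apply)
  next
    assume "\<forall>X \<in> codes. g (f X) = k (h_map m X)"
    then show ?thesis using inv by (intro disjI2 ballI) (metis comp_apply)
  qed
  ultimately show ?thesis unfolding aut_or_h_def by blast
qed

section \<open>Functions on sets with zero sum over every 3-partition\<close>

lemma ex_not_in_if_card_less:
  fixes A :: "'n::finite set"
  assumes "card A < CARD('n)"
  obtains i where "i \<notin> A"
  using assms by (metis UNIV_eq_I less_irrefl)

text \<open>For disjoint nonempty \<open>A\<close>, \<open>B\<close> that do not cover everything,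
  \<open>\<delta> A + \<delta> B\<close> is the value at the complement of the union, so it depends
  only on the union. Hence the defect \<open>\<delta> {i, j} + \<delta> {i} + \<delta> {j}\<close>
  is a constant \<open>c\<close>, and adjoining a point \<open>a\<close> to a set adds
  \<open>\<delta> {a} + c\<close>.\<close>

lemma partition_function_affine:
  fixes \<delta> :: "'n::finite set \<Rightarrow> bit"
  assumes card: "CARD('n) \<ge> 4"
    and sum0: "\<And>A B C. A \<noteq> {} \<Longrightarrow> B \<noteq> {} \<Longrightarrow> C \<noteq> {} \<Longrightarrow> A \<inter> B = {} \<Longrightarrow> A \<inter> C = {} \<Longrightarrow>
      B \<inter> C = {} \<Longrightarrow> A \<union> B \<union> C = UNIV \<Longrightarrow> \<delta> A + \<delta> B + \<delta> C = 0"
  obtains c l where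
    "\<And>A i j. A \<noteq> {} \<Longrightarrow> i \<notin> A \<Longrightarrow> j \<notin> A \<Longrightarrow> i \<noteq> j \<Longrightarrow> \<delta> A = c + (\<Sum>k\<in>A. l k)"
    "(\<Sum>k\<in>UNIV. l k) = c"
proof -
  have union: "\<delta> A + \<delta> B = \<delta> (- (A \<union> B))"
    if "A \<noteq> {}" "B \<noteq> {}" "A \<inter> B = {}" "t \<notin> A \<union> B" for A B t
  proof -
    have "\<delta> A + \<delta> B + \<delta> (- (A \<union> B)) = 0"
      using that by (intro sum0) auto
    then show ?thesis
      by (cases "\<delta> A"; cases "\<delta> B"; cases "\<delta> (- (A \<union> B))") auto
  qed
  have assoc: "\<delta> (A \<union> B) + \<delta> C = \<delta> A + \<delta> (B \<union> C)"
    if "A \<noteq> {}" "B \<noteq> {}" "C \<noteq> {}" "A \<inter> B = {}" "A \<inter> C = {}" "B \<inter> C = {}" "t \<notin> A \<union> B \<union> C"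
    for A B C t
    using union[of "A \<union> B" C t] union[of A "B \<union> C" t] that
    by (simp add: Un_assoc Int_Un_distrib Int_Un_distrib2)
  define k where "k i j = \<delta> {i, j} + \<delta> {i} + \<delta> {j}" for i j
  have k_sym: "k i j = k j i" for i j
    unfolding k_def by (simp only: insert_commute ac_simps)
  \<comment> \<open>The pairs \<open>{i, j}\<close>, \<open>{p}\<close> and \<open>{i}\<close>,
    \<open>{j, p}\<close> have the same union. A fourth coordinate keeps the complement nonempty,
    which is where \<open>n \<ge> 4\<close> enters.\<close>
  have k_shift: "k i j = k j p" if "i \<noteq> j" "j \<noteq> p" for i j p
  proof (cases "i = p")
    case False
    have "card {i, j, p} < CARD('n)" using card by (simp add: card_insert_if)
    then obtain t where "t \<notin> {i, j, p}" by (rule ex_not_in_if_card_less)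
    then have "\<delta> {i, j} + \<delta> {p} = \<delta> {i} + \<delta> {j, p}"
      using assoc[of "{i}" "{j}" "{p}" t] that False by (simp add: insert_commute)
    then show ?thesis unfolding k_def
      by (cases "\<delta> {i, j}"; cases "\<delta> {p}"; cases "\<delta> {i}"; cases "\<delta> {j, p}"; cases "\<delta> {j}") auto
  qed (use k_sym in simp)
  have "card ({} :: 'n set) < CARD('n)" using card by simp
  then obtain i0 :: 'n where "i0 \<notin> {}" by (rule ex_not_in_if_card_less)
  have "card {i0} < CARD('n)" using card by simp
  then obtain j0 where j0: "j0 \<notin> {i0}" by (rule ex_not_in_if_card_less)
  define c where "c = k i0 j0"
  define l where "l i = \<delta> {i} + c" for i
  have k_const: "k i j = c" if "i \<noteq> j" for i j
    using j0 that k_shift[of i j i0] k_shift[of j i0 j0] k_shift[of i i0 j0] unfolding c_def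
    by (cases "j = i0") auto
  have affine: "\<delta> A = c + (\<Sum>k\<in>A. l k)" if "A \<noteq> {}" "i \<notin> A" "j \<notin> A" "i \<noteq> j" for A i j
    using finite[of A] that
  proof (induction A rule: finite_ne_induct)
    case (singleton a)
    then show ?case by (cases c) (simp_all add: l_def add.left_commute)
  next
    case (insert a A)
    \<comment> \<open>Of the two points outside the set, \<open>i\<close> serves as an auxiliary
      block and \<open>j\<close> keeps the remaining block nonempty.\<close>
    then have "\<delta> (A \<union> {a}) + \<delta> {i} = \<delta> A + \<delta> ({a} \<union> {i})"
      by (intro assoc[where t = j]) auto
    moreover have "A \<union> {a} = insert a A" "{a} \<union> {i} = {a, i}" by auto
    ultimately have "\<delta> (insert a A) + \<delta> {i} = \<delta> A + \<delta> {a, i}" by simp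
    moreover have "\<delta> {a, i} + \<delta> {a} + \<delta> {i} = c"
      using k_const[of a i] insert.prems by (auto simp: k_def)
    ultimately have "\<delta> (insert a A) = \<delta> A + l a"
      by (simp add: l_def)
        (cases "\<delta> (insert a A)"; cases "\<delta> A"; cases "\<delta> {a}"; cases "\<delta> {i}"; cases "\<delta> {a, i}"; force)
    then show ?case using insert by (simp add: ac_simps)
  qed
  have "i0 \<noteq> j0" using j0 by simp
  have "card {i0, j0} < CARD('n)" using card by (simp add: card_insert_if)
  then obtain t where "t \<notin> {i0, j0}" by (rule ex_not_in_if_card_less)
  then have ne: "- {i0, j0} \<noteq> {}" by auto
  \<comment> \<open>In this partition each of the three values contributes one \<open>c\<close>, and
    three copies reduce to one; so the total of \<open>l\<close> must be \<open>c\<close>.\<close>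
  have "\<delta> {i0} + \<delta> {j0} + \<delta> (- {i0, j0}) = 0"
    using ne \<open>i0 \<noteq> j0\<close> by (intro sum0) auto
  moreover have "\<delta> (- {i0, j0}) = c + (\<Sum>k\<in>- {i0, j0}. l k)"
    using affine[OF ne, of i0 j0] \<open>i0 \<noteq> j0\<close> by simp
  moreover have "(\<Sum>k\<in>UNIV. l k) = (\<Sum>k\<in>{i0, j0} \<union> - {i0, j0}. l k)" by simp
  then have "(\<Sum>k\<in>UNIV. l k) = l i0 + l j0 + (\<Sum>k\<in>- {i0, j0}. l k)"
    using \<open>i0 \<noteq> j0\<close> by (subst (asm) sum.union_disjoint) auto
  ultimately have "(\<Sum>k\<in>UNIV. l k) = c"
    by (simp add: l_def[of i0] l_def[of j0])
      (cases "\<delta> {i0}"; cases "\<delta> {j0}"; cases c; cases "\<Sum>k\<in>- {i0, j0}. l k"; force)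
  then show thesis using that affine by blast
qed

section \<open>Codes\<close>

lemma codes_iff:
  "(X :: (bit ^ 'n::finite) set) \<in> codes \<longleftrightarrow> X \<in> Grass 2 \<and> (\<forall>i. \<exists>x \<in> X. x $ i = 1)"
  by (auto simp: codes_def coord_hyperplane_def subset_iff)

text \<open>No coordinate of \<open>1\<close> vanishes, so every plane through it is
  non-degenerate.\<close>

lemma codesA_iff: "(X :: (bit ^ 'n::finite) set) \<in> codesA \<longleftrightarrow> X \<in> Grass 2 \<and> 1 \<in> X"
proof -
  have "ones_line \<subseteq> X \<longleftrightarrow> 1 \<in> X" if "X \<in> Grass 2"
    using Grass2_zero[OF that] by (simp add: ones_line_def chi_one_eq span_singleton_eq)
  moreover have "X \<in> codes" if "X \<in> Grass 2" "1 \<in> X"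
    using that by (auto simp: codes_iff intro: bexI[of _ 1])
  ultimately show ?thesis by (auto simp: codesA_def codes_iff)
qed

lemma codesA_subset_codes: "codesA \<subseteq> codes"
  by (auto simp: codesA_def)

lemma span2_one_in_codesA:
  "x \<noteq> 0 \<Longrightarrow> x \<noteq> 1 \<Longrightarrow> span2 1 x \<in> (codesA :: (bit ^ 'n::finite) set set)"
  by (auto simp: codesA_iff span2_in_Grass) (simp add: span2_def)

lemma mem_span2_oneE:
  assumes "v \<in> span2 1 x" "v \<noteq> 0" "v \<noteq> (1 :: bit ^ 'n)"
  shows "v = x \<or> v = x + 1"
  using assms by (auto simp: span2_def ac_simps)

lemma codesA_obtain:
  assumes "(X :: (bit ^ 'n::finite) set) \<in> codesA"
  obtains x where "x \<noteq> 0" "x \<noteq> 1" "X = span2 1 x"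
  using assms Grass2_obtain[of X 1] by (metis codesA_iff vec_bit_one_neq_zero(1))

lemma Grass2_subset_eq:
  assumes "(X :: (bit ^ 'n::finite) set) \<in> Grass 2" "Y \<in> Grass 2" "X \<subseteq> Y"
  shows "X = Y"
proof -
  obtain a b where ab: "X = span2 a b" "a \<noteq> 0" "b \<noteq> 0" "a \<noteq> b"
    using assms(1) by (auto simp: Grass2_iff)
  then have "a \<in> Y" "b \<in> Y" using assms(3) by (auto simp: span2_def)
  then show ?thesis using ab Grass2_eq_span2[OF assms(2)] by metis
qed

lemma code_embD:
  fixes f :: "(bit ^ 'n::finite) set \<Rightarrow> (bit ^ 'n) set"
  assumes "code_emb f"
  shows "inj_on f codes" "X \<in> codes \<Longrightarrow> f X \<in> Grass 2"
    and "X \<in> codes \<Longrightarrow> Y \<in> codes \<Longrightarrow> X \<noteq> Y \<Longrightarrow> v \<in> X \<Longrightarrow> v \<in> Y \<Longrightarrow> v \<noteq> 0 \<Longrightarrow>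
      \<exists>w. w \<noteq> 0 \<and> w \<in> f X \<and> w \<in> f Y"
proof -
  show "inj_on f codes" using assms by (simp add: code_emb_def)
  show G: "f X \<in> Grass 2" if "X \<in> codes" for X using assms that by (auto simp: code_emb_def)
  assume XY: "X \<in> codes" "Y \<in> codes" "X \<noteq> Y" "v \<in> X" "v \<in> Y" "v \<noteq> 0"
  then have "adjacent X Y" using codes_subset_Grass by (subst adjacent_iff) auto
  then have "adjacent (f X) (f Y)" using assms XY by (simp add: code_emb_def)
  then show "\<exists>w. w \<noteq> 0 \<and> w \<in> f X \<and> w \<in> f Y" using G XY by (simp add: adjacent_iff)
qed

section \<open>Characteristic vectors and the codes given by 3-partitions of the coordinates\<close>

definition ind :: "'n set \<Rightarrow> bit ^ 'n" where
  "ind A = (\<chi> i. if i \<in> A then 1 else 0)"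

lemma ind_nth [simp]: "ind A $ i = (if i \<in> A then 1 else 0)"
  by (simp add: ind_def)

lemma ind_eq_iff [simp]: "ind A = ind B \<longleftrightarrow> A = B"
  by (auto simp: vec_eq_iff split: if_splits)

lemma ind_empty [simp]: "ind {} = 0"
  by (simp add: vec_eq_iff)

lemma ind_UNIV [simp]: "ind UNIV = 1"
  by (simp add: vec_eq_iff)

lemma ind_eq_0_iff [simp]: "ind A = 0 \<longleftrightarrow> A = {}"
  using ind_eq_iff[of A "{}"] by simp

lemma ind_eq_1_iff [simp]: "ind A = 1 \<longleftrightarrow> A = UNIV"
  using ind_eq_iff[of A UNIV] by simp

lemma one_eq_ind_iff [simp]: "1 = ind A \<longleftrightarrow> A = UNIV"
  using ind_eq_1_iff[of A] by metis

lemma ind_support: "ind {i. x $ i = 1} = (x :: bit ^ 'n)"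
  by (auto simp: vec_eq_iff)

text \<open>Each coordinate lies in exactly one block, so exactly one of the three vectors vanishes
  there. Thus they sum to 0 and no coordinate is zero on the whole span; as the blocks are nonempty,
  none of the vectors is \<open>1\<close>.\<close>

lemma span2_ind_compl_code:
  fixes A B C :: "'n::finite set"
  assumes "A \<noteq> {}" "B \<noteq> {}" "C \<noteq> {}" "A \<inter> B = {}" "A \<inter> C = {}" "B \<inter> C = {}" "A \<union> B \<union> C = UNIV"
  shows "span2 (ind (- A)) (ind (- B)) \<in> codes - codesA"
    and "ind (- A) + ind (- B) = ind (- C)"
proof -
  show sum: "ind (- A) + ind (- B) = ind (- C)"
    using assms by (auto simp: vec_eq_iff)
  have ne: "- A \<noteq> {}" "- B \<noteq> {}" "- A \<noteq> UNIV" "- B \<noteq> UNIV" "- C \<noteq> UNIV" "- A \<noteq> - B"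
    using assms by auto
  have G: "span2 (ind (- A)) (ind (- B)) \<in> Grass 2"
    using ne by (intro span2_in_Grass) auto
  moreover have "\<exists>x \<in> span2 (ind (- A)) (ind (- B)). x $ i = 1" for i
  proof (cases "i \<in> A")
    case True
    then have "ind (- B) $ i = 1" using assms by auto
    then show ?thesis by (auto simp: span2_def)
  next
    case False
    then have "ind (- A) $ i = 1" using assms by auto
    then show ?thesis by (auto simp: span2_def)
  qed
  moreover have "1 \<notin> span2 (ind (- A)) (ind (- B))"
    using ne by (simp add: span2_def sum)
  ultimately show "span2 (ind (- A)) (ind (- B)) \<in> codes - codesA"
    by (simp add: codes_iff codesA_iff)
qed

section \<open>Embeddings fixing the codes through the all-ones vector\<close>

text \<open>For additive \<open>l\<close> this is a transvection or the identity if
  \<open>l 1 = 0\<close>, and the projection along \<open>1\<close> onto the kernel of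
  \<open>l\<close> if \<open>l 1 = 1\<close>. Additivity is left out of the definition because
  \<open>l\<close> is also instantiated by a function whose linearity is still to be shown.\<close>

definition shear :: "(bit ^ 'n \<Rightarrow> bit) \<Rightarrow> bit ^ 'n \<Rightarrow> bit ^ 'n" where
  "shear l x = x + l x *s 1"

lemma shear_add:
  assumes "\<And>x y. l (x + y) = l x + l y"
  shows "shear l (x + y) = shear l x + shear l y"
  unfolding shear_def assms vector_sadd_rdistrib by (simp only: ac_simps)

lemma shear_cases: "shear l x = x \<or> shear l x = x + 1"
  by (cases "l x") (auto simp: shear_def)

text \<open>The vectors \<open>a\<close> and \<open>b\<close> differ modulo \<open>1\<close>, so any
  choice of representatives remains distinct.\<close>

lemma add_one_choice_neq:
  fixes a b :: "bit ^ 'n"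
  assumes "a \<noteq> b" "a + b \<noteq> 1" "a' = a \<or> a' = a + 1" "b' = b \<or> b' = b + 1"
  shows "a' \<noteq> b'"
  using assms by (auto simp: ac_simps)

lemma codes_minus_codesA_facts:
  assumes "(X :: (bit ^ 'n::finite) set) \<in> codes - codesA"
  shows "X \<in> Grass 2" "1 \<notin> X" "\<And>x. x \<in> X \<Longrightarrow> x + 1 \<notin> X" "\<exists>x \<in> X. x $ i = 1"
proof -
  show X: "X \<in> Grass 2" using assms codes_subset_Grass by auto
  show 1: "1 \<notin> X" using assms X by (auto simp: codesA_iff)
  show "x + 1 \<notin> X" if "x \<in> X" for x
    using Grass2_add[OF X that, of "x + 1"] 1 by auto
  show "\<exists>x \<in> X. x $ i = 1" using assms by (auto simp: codes_iff)
qed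

text \<open>The \<open>i\<close>-th coordinate is a nonzero functional on the plane, so its kernel
  there has only one nonzero vector.\<close>

lemma codes_minus_codesA_nth:
  assumes X: "(X :: (bit ^ 'n::finite) set) \<in> codes - codesA"
    and x: "x \<in> X" "x \<noteq> 0" "x $ i = 0" and y: "y \<in> X" "y \<noteq> 0" "y \<noteq> x"
  shows "y $ i = 1"
proof -
  have "X = span2 x y" using Grass2_eq_span2 codes_minus_codesA_facts(1)[OF X] x y by metis
  then show ?thesis using codes_minus_codesA_facts(4)[OF X, of i] x(3) by (auto simp: span2_def)
qed

text \<open>If \<open>x\<close> were supported at \<open>i\<close> alone, the other two nonzero
  vectors would be 1 off \<open>i\<close>. They differ at \<open>i\<close>, so one of them would be
  the all-ones vector.\<close>

lemma code_support_card:
  assumes X: "(X :: (bit ^ 'n::finite) set) \<in> codes - codesA" and x: "x \<in> X" "x \<noteq> 0"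
  obtains i j where "x $ i = 1" "x $ j = 1" "i \<noteq> j"
proof -
  note facts = codes_minus_codesA_facts[OF X]
  obtain i where i: "x $ i = 1" using x(2) by (rule vec_bit_neq_zeroE)
  obtain y where y: "y \<in> X" "y \<noteq> 0" "y \<noteq> x" "X = span2 x y"
    using Grass2_obtain[OF facts(1) x] .
  have "\<exists>j. j \<noteq> i \<and> x $ j = 1"
  proof (rule ccontr)
    assume no: "\<nexists>j. j \<noteq> i \<and> x $ j = 1"
    then have j: "y $ j = 1" "(x + y) $ j = 1" if "j \<noteq> i" for j
      using codes_minus_codesA_nth[OF X x, of j y] y that by auto
    have "y = 1 \<or> x + y = 1"
    proof (cases "y $ i = 1")
      case True
      then have "y $ j = 1" for j using j(1) by metis
      then show ?thesis by (simp add: vec_eq_iff)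
    next
      case False
      then have "(x + y) $ i = 1" using i by simp
      then have "(x + y) $ j = 1" for j using j(2) by metis
      then show ?thesis unfolding vec_eq_iff one_index by blast
    qed
    then show False using facts(1,2) x y Grass2_add by metis
  qed
  then show thesis using i that by metis
qed

text \<open>An embedding fixing every code through \<^term>\<open>1\<close> moves any other code inside the 3-dimensional
space that it spans together with \<^term>\<open>1\<close>. By adjacency a vector \<^term>\<open>x\<close> is moved to the same
\<^term>\<open>x + eps x *s 1\<close> in all codes, and \<^term>\<open>eps\<close> sums to 0 over every code. Since the complements of
the supports of the vectors of a code partition the coordinates, \<^term>\<open>eps\<close> is linear.\<close>

lemma code_emb_fixing_codesA:
  fixes f :: "(bit ^ 'n::finite) set \<Rightarrow> (bit ^ 'n) set"
  assumes card: "CARD('n) \<ge> 4" and emb: "code_emb f" and fix_A: "\<And>X. X \<in> codesA \<Longrightarrow> f X = X"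
  obtains l where "\<And>x y. l (x + y) = l x + l y" "\<And>X. X \<in> codes - codesA \<Longrightarrow> f X = shear l ` X"
proof -
  note emb_facts = code_embD[OF emb]
  note facts = codes_minus_codesA_facts
  have fG: "f X \<in> Grass 2" if "X \<in> codes - codesA" for X
    using emb_facts(2) that by blast
  \<comment> \<open>Otherwise \<open>f X\<close> would be a fixed code, contradicting
    injectivity.\<close>
  have f1: "1 \<notin> f X" if X: "X \<in> codes - codesA" for X
  proof
    assume "1 \<in> f X"
    then have "f X \<in> codesA" using fG[OF X] by (simp add: codesA_iff)
    then have "f (f X) = f X" "f X \<in> codes" using fix_A codesA_subset_codes by auto
    then have "f X = X" using emb_facts(1) X by (auto dest: inj_onD)
    then show False using \<open>f X \<in> codesA\<close> X by simp
  qed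
  have f1': "x + 1 \<notin> f X" if X: "X \<in> codes - codesA" and "x \<in> f X" for X x
    using Grass2_add[OF fG[OF X] that(2), of "x + 1"] f1[OF X] by auto
  \<comment> \<open>Adjacency is used with the code through \<open>1\<close> and \<open>x\<close>,
    which \<open>f\<close> fixes: \<open>f X\<close> meets it in a vector other than
    \<open>1\<close>.\<close>
  have meet: "x \<in> f X \<or> x + 1 \<in> f X" if X: "X \<in> codes - codesA" and x: "x \<in> X" "x \<noteq> 0" for X x
  proof -
    have x1: "x \<noteq> 1" using facts(2)[OF X] x by auto
    have S: "span2 1 x \<in> codesA" using x x1 by (intro span2_one_in_codesA)
    moreover have "x \<in> span2 1 x" by (simp add: span2_def)
    ultimately obtain w where w: "w \<noteq> 0" "w \<in> f X" "w \<in> f (span2 1 x)"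
      using emb_facts(3)[of X "span2 1 x" x] x X codesA_subset_codes by auto
    then have "w \<in> span2 1 x" using fix_A S by simp
    then have "w = x \<or> w = x + 1" using w f1[OF X] by (auto dest: mem_span2_oneE)
    then show ?thesis using w by auto
  qed
  \<comment> \<open>Two independent vectors of \<open>X\<close>, each possibly shifted by
    \<open>1\<close>, already generate \<open>f X\<close>.\<close>
  have shadow: "v \<in> X \<or> v + 1 \<in> X" if X: "X \<in> codes - codesA" and v: "v \<in> f X" for X v
  proof -
    obtain a b where ab: "a \<noteq> 0" "b \<noteq> 0" "a \<noteq> b" "X = span2 a b"
      using facts(1)[OF X] by (auto simp: Grass2_iff)
    then have abX: "a \<in> X" "b \<in> X" by (auto simp: span2_def)
    obtain a' where a': "a' \<in> f X" "a' = a \<or> a' = a + 1" using meet[OF X abX(1) ab(1)] by auto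
    obtain b' where b': "b' \<in> f X" "b' = b \<or> b' = b + 1" using meet[OF X abX(2) ab(2)] by auto
    have "a \<noteq> 1" "b \<noteq> 1" "a + b \<noteq> 1"
      using facts(2)[OF X] ab by (auto simp: span2_def)
    then have "a' \<noteq> 0" "b' \<noteq> 0" "a' \<noteq> b'"
      using ab a'(2) b'(2) add_one_choice_neq[of a b a' b'] by auto
    then have "f X = span2 a' b'" using Grass2_eq_span2 fG[OF X] a' b' by metis
    then show ?thesis using v a' b' ab(4) by (auto simp: span2_def ac_simps)
  qed
  have consistent: "x \<in> f X'"
    if X: "X \<in> codes - codesA" and X': "X' \<in> codes - codesA"
      and x: "x \<in> X" "x \<in> X'" "x \<noteq> 0" "x \<in> f X" for X X' x
  proof (cases "X = X'")
    case False
    obtain v where v: "v \<noteq> 0" "v \<in> f X" "v \<in> f X'"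
      using emb_facts(3)[of X X' x] X X' False x by auto
    \<comment> \<open>At a coordinate where \<open>x\<close> vanishes, all other nonzero vectors of
      \<open>X\<close> and \<open>X'\<close> are 1. If the counterparts \<open>u\<close>,
      \<open>u'\<close> of the common vector \<open>v\<close> both differed from \<open>x\<close>,
      they would agree there and hence everywhere, since they agree modulo \<open>1\<close>; then
      \<open>X\<close> and \<open>X'\<close> would share two vectors.\<close>
    obtain i where i: "x $ i = 0"
      using facts(2)[OF X] x(1) vec_bit_neq_oneE[of x] by metis
    obtain u where u: "u \<in> X" "u = v \<or> u = v + 1" using shadow[OF X v(2)] by auto
    obtain u' where u': "u' \<in> X'" "u' = v \<or> u' = v + 1" using shadow[OF X' v(3)] by auto
    have "v \<noteq> 1" using v f1[OF X] by auto
    then have nz: "u \<noteq> 0" "u' \<noteq> 0" using u(2) u'(2) v by auto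
    have "u = x \<or> u' = x"
    proof (rule ccontr)
      assume "\<not> (u = x \<or> u' = x)"
      then have "u $ i = 1" "u' $ i = 1"
        using codes_minus_codesA_nth[OF X x(1,3) i u(1) nz(1)]
          codes_minus_codesA_nth[OF X' x(2,3) i u'(1) nz(2)] by auto
      then have "u = u'" using u(2) u'(2) by auto
      then have "X = X'"
        using Grass2_cong[OF facts(1)[OF X] facts(1)[OF X'] u(1) x(1) _ x(2) nz(1) x(3)] u'
          \<open>\<not> (u = x \<or> u' = x)\<close> by auto
      then show False using False by simp
    qed
    then have "v = x \<or> v = x + 1" using u(2) u'(2) by auto
    then have "v = x" using f1'[OF X x(4)] v by auto
    then show ?thesis using v by simp
  qed (use x in simp)
  \<comment> \<open>By consistency a vector kept in one code is kept in all codes through it that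
    avoid \<open>1\<close>, so testing a single code suffices.\<close>
  define eps :: "bit ^ 'n \<Rightarrow> bit" where
    "eps x = (if \<exists>X \<in> codes - codesA. x \<in> X \<and> x \<in> f X then 0 else 1)" for x
  have shear_eps: "shear eps x \<in> f X" if X: "X \<in> codes - codesA" and x: "x \<in> X" "x \<noteq> 0" for X x
  proof (cases "x \<in> f X")
    case True
    then have "eps x = 0" using X x by (auto simp: eps_def)
    then show ?thesis using True by (simp add: shear_def)
  next
    case False
    then have "eps x = 1" using X x consistent by (auto simp: eps_def)
    then show ?thesis using False meet[OF X x] by (simp add: shear_def)
  qed
  have eps_add: "eps x + eps y + eps (x + y) = 0"
    if X: "X \<in> codes - codesA" and xy: "x \<in> X" "y \<in> X" "x \<noteq> 0" "y \<noteq> 0" "x \<noteq> y" for X x y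
  proof (rule ccontr)
    assume no: "eps x + eps y + eps (x + y) \<noteq> 0"
    have "x + y \<in> X" "x + y \<noteq> 0" using Grass2_add facts(1)[OF X] xy by auto
    \<comment> \<open>The three vectors sum to 0, so their shifted versions sum to a multiple of
      \<open>1\<close>, which must be zero because \<open>f X\<close> avoids
      \<open>1\<close>.\<close>
    then have "shear eps x + shear eps y + shear eps (x + y) \<in> f X"
      using fG[OF X] shear_eps[OF X] xy by (intro Grass2_add) auto
    moreover have "shear eps x + shear eps y + shear eps (x + y) = (x + y + (x + y)) + (eps x + eps y + eps (x + y)) *s 1"
      unfolding shear_def vector_sadd_rdistrib by (simp only: ac_simps)
    moreover have "eps x + eps y + eps (x + y) = 1" using no bit_not_zero_iff by blast
    ultimately show False using f1[OF X] by simp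
  qed
  have "eps (ind (- A)) + eps (ind (- B)) + eps (ind (- C)) = 0"
    if "A \<noteq> {}" "B \<noteq> {}" "C \<noteq> {}" "A \<inter> B = {}" "A \<inter> C = {}" "B \<inter> C = {}" "A \<union> B \<union> C = UNIV" for A B C
  proof -
    note code = span2_ind_compl_code[OF that]
    have "- A \<noteq> {}" "- B \<noteq> {}" "- A \<noteq> - B" using that by auto
    then show ?thesis
      using eps_add[OF code(1), of "ind (- A)" "ind (- B)"] code(2) by (simp add: span2_def)
  qed
  then obtain c l where
    l: "\<And>A i j. A \<noteq> {} \<Longrightarrow> i \<notin> A \<Longrightarrow> j \<notin> A \<Longrightarrow> i \<noteq> j \<Longrightarrow> eps (ind (- A)) = c + (\<Sum>k\<in>A. l k)"
    and c: "(\<Sum>k\<in>UNIV. l k) = c"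
    using partition_function_affine[OF card, of "\<lambda>A. eps (ind (- A))"] by metis
  define lam where "lam x = (\<Sum>i\<in>UNIV. l i * x $ i)" for x :: "bit ^ 'n"
  have lam_add: "lam (x + y) = lam x + lam y" for x y
    unfolding lam_def vector_add_component distrib_left sum.distrib ..
  have eps_lam: "eps x = lam x" if X: "X \<in> codes - codesA" and x: "x \<in> X" "x \<noteq> 0" for X x
  proof -
    define A where "A = {i. x $ i = 0}"
    have "A \<noteq> {}" using facts(2)[OF X] x(1) vec_bit_neq_oneE[of x] by (auto simp: A_def)
    moreover obtain i j where "i \<notin> A" "j \<notin> A" "i \<noteq> j"
      using code_support_card[OF X x] by (auto simp: A_def)
    moreover have "ind (- A) = x" by (auto simp: A_def vec_eq_iff)
    \<comment> \<open>The affine formula is over the zero set of \<open>x\<close>. As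
      \<open>c\<close> is the total of \<open>l\<close>, it turns into the sum over the support,
      which is the linear functional \<open>lam\<close>.\<close>
    ultimately have "eps x = c + (\<Sum>k\<in>A. l k)" using l by metis
    moreover have "c = (\<Sum>k\<in>A. l k) + (\<Sum>k\<in>- A. l k)"
      unfolding c[symmetric] by (subst sum.union_disjoint[symmetric]) auto
    moreover have "lam x = (\<Sum>k\<in>- A. l k)"
      unfolding lam_def by (rule sum.mono_neutral_cong_right) (auto simp: A_def)
    ultimately show ?thesis
      by (cases "\<Sum>k\<in>A. l k"; cases "\<Sum>k\<in>- A. l k") auto
  qed
  have "f X = shear lam ` X" if X: "X \<in> codes - codesA" for X
  proof -
    obtain a b where ab: "a \<noteq> 0" "b \<noteq> 0" "a \<noteq> b" "X = span2 a b"
      using facts(1)[OF X] by (auto simp: Grass2_iff)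
    have "a \<noteq> 1" "b \<noteq> 1" "a + b \<noteq> 1"
      using facts(2)[OF X] ab by (auto simp: span2_def)
    then have "shear lam a \<noteq> 0" "shear lam b \<noteq> 0" "shear lam a \<noteq> shear lam b"
      using ab shear_cases[of lam a] shear_cases[of lam b]
        add_one_choice_neq[of a b "shear lam a" "shear lam b"] by auto
    then have "shear lam ` X \<in> Grass 2"
      unfolding ab(4) image_span2[of "shear lam", OF shear_add, OF lam_add] by (intro span2_in_Grass)
    moreover have "shear lam x \<in> f X" if "x \<in> X" for x
    proof (cases "x = 0")
      case True
      have "lam 0 = 0" using lam_add[of 0 0] by simp
      then show ?thesis using True Grass2_zero[OF fG[OF X]] by (simp add: shear_def)
    next
      case False
      then show ?thesis using shear_eps[OF X that] eps_lam[OF X that] by (simp add: shear_def)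
    qed
    then have "shear lam ` X \<subseteq> f X" by auto
    ultimately show ?thesis using Grass2_subset_eq fG[OF X] by metis
  qed
  then show thesis using that lam_add by metis
qed

section \<open>The map \<open>h\<close> as projection along the all-ones vector onto H\<close>

lemma line_of_eq: "line_of I = {0, ind I :: bit ^ 'n::finite}"
  by (simp add: line_of_def span_singleton_eq flip: ind_def)

lemma ind_compl: "ind (- A) = ind A + 1"
  by (simp add: vec_eq_iff)

text \<open>The functional kills the spanning vectors of H and takes the value 1 at
  \<open>1\<close>. Conversely, every vector lies in H modulo \<open>1\<close>, and the value of
  \<open>l\<close> decides which of \<open>x\<close>, \<open>x + 1\<close> is in H.\<close>

lemma hyp_eq_kernel:
  fixes m :: "'n::finite"
  obtains l :: "bit ^ 'n \<Rightarrow> bit" where "\<And>x y. l (x + y) = l x + l y" "l 1 = 1" "\<And>x. x \<in> hyp m \<longleftrightarrow> l x = 0"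
proof -
  \<comment> \<open>The weight at \<open>m\<close> makes the total weight 1; then
    \<open>ind {i} + 1\<close> has value \<open>1 + 1 = 0\<close> for
    \<open>i \<noteq> m\<close>.\<close>
  define c :: "'n \<Rightarrow> bit" where "c i = (if i = m then 1 + (\<Sum>j\<in>- {m}. 1) else 1)" for i
  define l where "l x = (\<Sum>i\<in>UNIV. c i * x $ i)" for x :: "bit ^ 'n"
  have add: "l (x + y) = l x + l y" for x y
    unfolding l_def vector_add_component distrib_left sum.distrib ..
  have l0: "l 0 = 0" using add[of 0 0] by simp
  have "(\<Sum>i\<in>UNIV. c i) = c m + (\<Sum>i\<in>- {m}. c i)"
    by (subst sum.remove[of UNIV m]) (auto simp: Compl_eq_Diff_UNIV)
  also have "(\<Sum>i\<in>- {m}. c i) = (\<Sum>j\<in>- {m}. 1)"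
    by (rule sum.cong) (auto simp: c_def)
  finally have l1: "l 1 = 1"
    by (simp add: l_def c_def add.assoc del: sum_constant)
  have li: "l (ind {i}) = c i" for i
    by (simp add: l_def if_distrib cong: if_cong)
  have hyp_eq: "hyp m = vec.span (\<Union>i \<in> - {m}. {0, ind {i} + 1})"
    by (simp add: hyp_def coline_of_def line_of_eq ind_compl)
  have sub: "vec.subspace (hyp m)" unfolding hyp_def by (rule vec.subspace_span)
  have gen: "ind {i} + 1 \<in> hyp m" if "i \<noteq> m" for i
    unfolding hyp_eq using that by (intro vec.span_base) auto
  have ker: "l x = 0" if "x \<in> hyp m" for x
  proof -
    have "hyp m \<subseteq> {x. l x = 0}" unfolding hyp_eq
    proof (rule vec.span_minimal)
      show "vec.subspace {x. l x = 0}" by (simp add: vec_bit_subspace_iff add l0)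
      show "(\<Union>i \<in> - {m}. {0, ind {i} + 1}) \<subseteq> {x. l x = 0}"
        by (auto simp: l0 l1 add li c_def)
    qed
    then show ?thesis using that by auto
  qed
  have ind_mem: "ind A \<in> hyp m \<or> ind A + 1 \<in> hyp m" if "m \<notin> A" for A
    using finite[of A] that
  proof (induction A rule: finite_induct)
    case empty
    then show ?case using vec.subspace_0[OF sub] by simp
  next
    case (insert a A)
    have eq: "ind (insert a A) = ind {a} + ind A"
      using insert by (auto simp: vec_eq_iff)
    have "ind A \<in> hyp m \<or> ind A + 1 \<in> hyp m" using insert by auto
    then show ?case
    proof
      assume "ind A \<in> hyp m"
      with gen[of a] insert have "(ind {a} + 1) + ind A \<in> hyp m"
        using vec.subspace_add[OF sub] by auto
      then show ?thesis by (simp add: eq ac_simps)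
    next
      assume "ind A + 1 \<in> hyp m"
      moreover have "ind {a} + 1 \<in> hyp m" using gen insert by auto
      ultimately have "(ind {a} + 1) + (ind A + 1) \<in> hyp m"
        using vec.subspace_add[OF sub] by metis
      then show ?thesis by (simp add: eq ac_simps)
    qed
  qed
  have mem: "x \<in> hyp m \<or> x + 1 \<in> hyp m" for x
  proof (cases "x $ m = 1")
    case True
    define A where "A = {i. x $ i = 0}"
    have "m \<notin> A" using True by (simp add: A_def)
    moreover have "x = ind A + 1" by (auto simp: A_def vec_eq_iff)
    then have "ind A = x + 1" by (simp add: ac_simps)
    ultimately show ?thesis using ind_mem[of A] by (auto simp: ac_simps)
  next
    case False
    then show ?thesis using ind_mem[of "{i. x $ i = 1}"] by (simp add: ind_support)
  qed
  have "x \<in> hyp m" if "l x = 0" for x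
  proof -
    have "l (x + 1) \<noteq> 0" using that add l1 by simp
    then show ?thesis using mem[of x] ker by auto
  qed
  then have "x \<in> hyp m \<longleftrightarrow> l x = 0" for x using ker by blast
  then show thesis by (rule that[OF add l1])
qed

text \<open>Passing to complements adds \<open>1\<close> to the two vectors of \<open>X\<close>
  outside H, as the shear does. The third nonzero vector is their sum, in which the two shifts
  cancel.\<close>

lemma code_compl_eq_shear:
  fixes m :: "'n::finite"
  assumes X: "X \<in> codesC m" and add: "\<And>x y. l (x + y) = l x + l y"
    and hyp: "\<And>x. x \<in> hyp m \<longleftrightarrow> l x = 0"
  shows "code_compl m X = shear l ` X"
proof -
  have XN: "X \<in> codes - codesA" and XB: "X \<notin> codesB m" using X by (auto simp: codesC_def)
  note facts = codes_minus_codesA_facts[OF XN]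
  have l0: "l 0 = 0" using add[of 0 0] by simp
  have off: "I \<in> off_hyp m X \<longleftrightarrow> ind I \<in> X \<and> l (ind I) = 1" for I
    using l0 Grass2_zero[OF facts(1)] facts(2)
    by (cases "I = {}"; cases "I = UNIV") (auto simp: off_hyp_def line_of_eq hyp)
  have compl_eq: "code_compl m X = vec.span (\<Union>I \<in> off_hyp m X. {0, ind I + 1})"
    by (simp add: code_compl_def coline_of_def line_of_eq ind_compl)
  have sub: "vec.subspace (code_compl m X)" unfolding code_compl_def by (rule vec.subspace_span)
  have gen: "x + 1 \<in> code_compl m X" if "x \<in> X" "l x = 1" for x
  proof -
    have "{i. x $ i = 1} \<in> off_hyp m X" using that by (simp add: off ind_support)
    then show ?thesis unfolding compl_eq
      by (intro vec.span_base) (force simp: ind_support)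
  qed
  show ?thesis
  proof
    show "code_compl m X \<subseteq> shear l ` X" unfolding compl_eq
    proof (rule vec.span_minimal)
      have "shear l x + shear l y \<in> shear l ` X" if "x \<in> X" "y \<in> X" for x y
        using that Grass2_add[OF facts(1)] by (simp flip: shear_add[of l, OF add])
      moreover have "0 \<in> shear l ` X"
        using Grass2_zero[OF facts(1)] by (auto simp: shear_def l0 image_iff intro!: bexI[of _ 0])
      ultimately show "vec.subspace (shear l ` X)" by (auto simp: vec_bit_subspace_iff)
      have "ind I + 1 \<in> shear l ` X" if "I \<in> off_hyp m X" for I
        using that by (auto simp: off shear_def image_iff intro!: bexI[of _ "ind I"])
      then show "(\<Union>I \<in> off_hyp m X. {0, ind I + 1}) \<subseteq> shear l ` X"
        using \<open>0 \<in> shear l ` X\<close> by auto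
    qed
    have "X \<in> codes" using XN by auto
    then obtain y where "y \<in> X" "y \<notin> hyp m" using XB by (auto simp: codesB_def)
    then have y: "y \<in> X" "l y = 1" by (auto simp: hyp)
    have "shear l x \<in> code_compl m X" if x: "x \<in> X" for x
    proof (cases "l x = 1")
      case True
      then show ?thesis using gen x by (simp add: shear_def)
    next
      case False
      then have lx: "l x = 0" by simp
      then have "(y + 1) + ((x + y) + 1) \<in> code_compl m X"
        using x y Grass2_add[OF facts(1)] by (intro vec.subspace_add[OF sub] gen) (auto simp: add)
      then show ?thesis using lx by (simp add: shear_def ac_simps)
    qed
    then show "shear l ` X \<subseteq> code_compl m X" by auto
  qed
qed

text \<open>Unifies the cases of \<open>h\<close> away from \<open>codesA\<close>: on a code inside
  H the functional vanishes, so the shear is the identity there as well.\<close>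

lemma h_map_eq_shear:
  fixes m :: "'n::finite"
  assumes X: "X \<in> codes - codesA" and add: "\<And>x y. l (x + y) = l x + l y"
    and hyp: "\<And>x. x \<in> hyp m \<longleftrightarrow> l x = 0"
  shows "h_map m X = shear l ` X"
proof (cases "X \<in> codesC m")
  case True
  then show ?thesis using code_compl_eq_shear[OF True add hyp] by (simp add: h_map_def)
next
  case False
  then have "X \<subseteq> hyp m" using X by (auto simp: codesC_def codesB_def)
  then have "shear l x = x" if "x \<in> X" for x using that hyp by (auto simp: shear_def)
  then show ?thesis using False by (simp add: h_map_def)
qed

lemma h_map_codesA: "X \<in> codesA \<Longrightarrow> h_map m X = X"
  by (auto simp: h_map_def codesC_def)

text \<open>As \<open>l 1 = 0\<close>, the outer functional does not see the shift made by the inner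
  shear, so the functionals add up.\<close>

lemma shear_shear:
  assumes "\<And>x y. l (x + y) = l x + l y" "l 1 = 0"
  shows "shear l (shear p x) = shear (\<lambda>x. l x + p x) x"
proof -
  have "l (p x *s 1) = 0"
    using assms(1)[of 0 0] assms(2) by (cases "p x") auto
  then show ?thesis unfolding shear_def assms(1)
    by (simp add: vector_sadd_rdistrib ac_simps)
qed

text \<open>Composing the shear with itself doubles the functional, so it is an involution.\<close>

lemma graph_aut_shear:
  fixes l :: "bit ^ 'n::finite \<Rightarrow> bit"
  assumes add: "\<And>x y. l (x + y) = l x + l y" and "l 1 = 0"
  shows "graph_aut (image (shear l)) grassmann_graph"
proof (rule graph_aut_image)
  show "shear l (x + y) = shear l x + shear l y" for x y using shear_add[of l, OF add] .
  have "shear l (shear l x) = x" for x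
    unfolding shear_shear[OF assms] by (simp add: shear_def)
  then show "inj (shear l)" by (metis injI)
qed

lemma image_shear_codesA:
  fixes l :: "bit ^ 'n::finite \<Rightarrow> bit"
  assumes X: "X \<in> codesA" and add: "\<And>x y. l (x + y) = l x + l y" and l1: "l 1 = 0"
  shows "shear l ` X = X"
proof -
  obtain x where x: "X = span2 1 x" using codesA_obtain[OF X] by metis
  have "shear l 1 = 1" using l1 by (simp add: shear_def)
  then show ?thesis
    unfolding x image_span2[of "shear l", OF shear_add, OF add]
    using shear_cases[of l x] by (auto simp: span2_def ac_simps)
qed

lemma aut_or_h_if_fixing_codesA:
  fixes f :: "(bit ^ 'n::finite) set \<Rightarrow> (bit ^ 'n) set"
  assumes "CARD('n) \<ge> 4" and "code_emb f" and fix_A: "\<And>X. X \<in> codesA \<Longrightarrow> f X = X"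
  shows "aut_or_h m f"
proof -
  obtain l where l: "\<And>x y. l (x + y) = l x + l y"
    and f: "\<And>X. X \<in> codes - codesA \<Longrightarrow> f X = shear l ` X"
    using code_emb_fixing_codesA[OF assms(1,2) fix_A] by metis
  obtain p :: "bit ^ 'n \<Rightarrow> bit" where p: "\<And>x y. p (x + y) = p x + p y" "p 1 = 1"
    and hyp: "\<And>x. x \<in> hyp m \<longleftrightarrow> p x = 0"
    using hyp_eq_kernel[of m] by metis
  show ?thesis
  proof (cases "l 1 = 0")
    case True
    have "f X = shear l ` X" if "X \<in> codes" for X
      using that f fix_A image_shear_codesA[OF _ l True] by (cases "X \<in> codesA") auto
    then show ?thesis unfolding aut_or_h_def using graph_aut_shear[OF l True] by blast
  next
    case False
    \<comment> \<open>Both \<open>l\<close> and \<open>p\<close> take the value 1 at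
      \<open>1\<close>, so \<open>q\<close> vanishes there and its shear is invertible; it carries
      the projection onto H to the projection onto the kernel of \<open>l\<close>.\<close>
    define q where "q x = l x + p x" for x
    have q: "q (x + y) = q x + q y" for x y unfolding q_def l p(1) by (simp only: ac_simps)
    have q1: "q 1 = 0" using False p(2) by (simp add: q_def)
    have "f X = shear q ` h_map m X" if "X \<in> codes" for X
    proof (cases "X \<in> codesA")
      case True
      then show ?thesis using fix_A h_map_codesA image_shear_codesA[OF _ q q1] by metis
    next
      case False
      then have X: "X \<in> codes - codesA" using that by simp
      have "q x + p x = l x" for x by (simp add: q_def add.assoc)
      then have "shear q (shear p x) = shear l x" for x
        unfolding shear_shear[OF q q1] by simp
      then show ?thesis unfolding f[OF X] h_map_eq_shear[OF X p(1) hyp] by (simp add: image_image)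
    qed
    then show ?thesis unfolding aut_or_h_def using graph_aut_shear[OF q q1] by blast
  qed
qed

section \<open>Linearity modulo the all-ones vector\<close>

lemma span2_one_add_one: "span2 1 (x + 1) = span2 1 (x :: bit ^ 'n)"
  by (auto simp: span2_def ac_simps)

lemma span2_one_cong: "v = x \<or> v = x + 1 \<Longrightarrow> span2 1 v = span2 1 (x :: bit ^ 'n)"
  using span2_one_add_one by auto

lemma span2_one_eqD:
  assumes "span2 1 x = span2 1 y" "x \<noteq> 0" "x \<noteq> (1 :: bit ^ 'n)"
  shows "x = y \<or> x = y + 1"
proof -
  have "x \<in> span2 1 y" using assms(1) by (auto simp: span2_def)
  then show ?thesis using assms by (auto dest: mem_span2_oneE)
qed

text \<open>By finiteness \<open>f\<close> permutes \<open>codesA\<close>, so \<open>f X\<close>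
  avoids \<open>1\<close>. It meets the images of the three codes joining \<open>1\<close> to a
  vector of \<open>X\<close> in three distinct nonzero vectors, which must sum to 0. Since
  \<open>u\<close> and \<open>v\<close> are only representatives modulo \<open>1\<close>, so is
  their sum.\<close>

lemma code_emb_codesA_additive:
  fixes f :: "(bit ^ 'n::finite) set \<Rightarrow> (bit ^ 'n) set"
  assumes emb: "code_emb f" and f_A: "f ` codesA \<subseteq> codesA"
    and X: "X \<in> codes - codesA" and x: "x \<in> X" "x \<noteq> 0" and y: "y \<in> X" "y \<noteq> 0" "x \<noteq> y"
    and u: "f (span2 1 x) = span2 1 u" and v: "f (span2 1 y) = span2 1 v"
  shows "f (span2 1 (x + y)) = span2 1 (u + v)"
proof -
  note emb_facts = code_embD[OF emb]
  note facts = codes_minus_codesA_facts[OF X]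
  have inj_A: "inj_on f codesA"
    using emb_facts(1) codesA_subset_codes by (rule inj_on_subset)
  then have surj: "f ` codesA = codesA" using f_A by (intro endo_inj_surj) auto
  have fX: "f X \<in> Grass 2" using emb_facts(2) X by blast
  have "f X \<notin> codesA"
  proof
    assume "f X \<in> codesA"
    then obtain Y where "Y \<in> codesA" "f X = f Y" using surj by (metis imageE)
    then have "X = Y" using emb_facts(1) X codesA_subset_codes by (auto dest: inj_onD)
    then show False using X \<open>Y \<in> codesA\<close> by simp
  qed
  then have one: "1 \<notin> f X" using fX by (simp add: codesA_iff)
  have xy: "x + y \<in> X" "x + y \<noteq> 0" using facts(1) x y Grass2_add by auto
  have not1: "z \<noteq> 1" if "z \<in> X" for z using that facts(2) by auto
  have A: "span2 1 z \<in> codesA" if "z \<in> X" "z \<noteq> 0" for z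
    using that not1 by (intro span2_one_in_codesA) auto
  have meet: "\<exists>w. w \<noteq> 0 \<and> w \<noteq> 1 \<and> w \<in> f X \<and> w \<in> f (span2 1 z) \<and> f (span2 1 z) = span2 1 w"
    if z: "z \<in> X" "z \<noteq> 0" for z
  proof -
    have "X \<noteq> span2 1 z" using facts(2) by (auto simp: span2_def)
    moreover have "z \<in> span2 1 z" by (simp add: span2_def)
    ultimately obtain w where w: "w \<noteq> 0" "w \<in> f X" "w \<in> f (span2 1 z)"
      using emb_facts(3)[of X "span2 1 z" z] z X A[OF z] codesA_subset_codes by auto
    moreover have "f (span2 1 z) \<in> codesA" using A[OF z] f_A by auto
    then have "f (span2 1 z) = span2 1 w"
      using w one by (intro Grass2_eq_span2) (auto simp: codesA_iff)
    ultimately show ?thesis using one by auto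
  qed
  have distinct: "f (span2 1 z) \<noteq> f (span2 1 z')"
    if "z \<in> X" "z' \<in> X" "z \<noteq> 0" "z' \<noteq> 0" "z \<noteq> z'" for z z'
  proof
    assume "f (span2 1 z) = f (span2 1 z')"
    then have "span2 1 z = span2 1 z'" using inj_A A that by (auto dest: inj_onD)
    then have "z = z' \<or> z = z' + 1" using that not1 by (intro span2_one_eqD) auto
    then show False using that facts(3) by auto
  qed
  obtain u' where u': "u' \<noteq> 0" "u' \<noteq> 1" "u' \<in> f X" "f (span2 1 x) = span2 1 u'"
    using meet[OF x] by auto
  obtain v' where v': "v' \<noteq> 0" "v' \<noteq> 1" "v' \<in> f X" "f (span2 1 y) = span2 1 v'"
    using meet[OF y(1,2)] by auto
  obtain p where p: "p \<noteq> 0" "p \<noteq> 1" "p \<in> f X" "f (span2 1 (x + y)) = span2 1 p"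
    using meet[OF xy] by auto
  have "u' \<noteq> v'" using distinct[of x y] x y u' v' by auto
  moreover have "p \<noteq> u'" using distinct[of "x + y" x] x y xy p u' by auto
  moreover have "p \<noteq> v'" using distinct[of "x + y" y] x y xy p v' by auto
  moreover have "f X = span2 u' v'" using Grass2_eq_span2[OF fX] u' v' \<open>u' \<noteq> v'\<close> by metis
  ultimately have "p = u' + v'" using p by (auto simp: span2_def)
  moreover have "u' = u \<or> u' = u + 1" using span2_one_eqD[of u' u] u u' by auto
  moreover have "v' = v \<or> v' = v + 1" using span2_one_eqD[of v' v] v v' by auto
  ultimately have "p = u + v \<or> p = u + v + 1" by (auto simp: ac_simps)
  then show ?thesis using p(4) span2_one_cong by metis
qed

lemma code_emb_codesA_linear:
  fixes f :: "(bit ^ 'n::finite) set \<Rightarrow> (bit ^ 'n) set"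
  assumes emb: "code_emb f" and f_A: "f ` codesA \<subseteq> codesA"
  obtains L :: "bit ^ 'n \<Rightarrow> bit ^ 'n" where
    "\<And>x y. L (x + y) = L x + L y" "inj L" "\<And>X. X \<in> codesA \<Longrightarrow> f X = L ` X"
proof -
  fix m :: 'n
  have "\<exists>w. f (span2 1 x) = span2 1 w" if "x \<noteq> 0" "x \<noteq> 1" for x
    using f_A span2_one_in_codesA[OF that] codesA_obtain by (metis image_subset_iff)
  then obtain t where t: "\<And>x. x \<noteq> 0 \<Longrightarrow> x \<noteq> 1 \<Longrightarrow> f (span2 1 x) = span2 1 (t x)"
    by metis
  \<comment> \<open>Representatives are chosen freely at the unit vectors other than the
    \<open>m\<close>-th; the value at \<open>m\<close> is forced by requiring
    \<open>L 1 = 1\<close>.\<close>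
  define w where "w i = (if i = m then 1 + (\<Sum>j\<in>- {m}. t (ind {j})) else t (ind {i}))" for i
  define L where "L x = (\<Sum>i\<in>UNIV. x $ i *s w i)" for x
  have add: "L (x + y) = L x + L y" for x y
    unfolding L_def vector_add_component vector_sadd_rdistrib sum.distrib ..
  have L0: "L 0 = 0" using add[of 0 0] by simp
  have "L 1 = w m + (\<Sum>i\<in>- {m}. w i)"
    unfolding L_def by (subst sum.remove[of UNIV m]) (auto simp: Compl_eq_Diff_UNIV)
  also have "(\<Sum>i\<in>- {m}. w i) = (\<Sum>j\<in>- {m}. t (ind {j}))"
    by (rule sum.cong) (auto simp: w_def)
  finally have L1: "L 1 = 1" by (simp add: w_def add.assoc)
  have L_single: "L (ind {i}) = w i" for i
  proof -
    have "L (ind {i}) = (\<Sum>j\<in>UNIV. if j = i then w j else 0)"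
      unfolding L_def by (rule sum.cong) auto
    then show ?thesis by simp
  qed
  have single: "f (span2 1 (ind {i})) = span2 1 (L (ind {i}))" if "i \<noteq> m" for i
  proof -
    have "{i} \<noteq> UNIV" using that by (metis UNIV_I singletonD)
    then have "f (span2 1 (ind {i})) = span2 1 (t (ind {i}))" by (intro t) auto
    then show ?thesis using that by (simp add: L_single w_def)
  qed
  \<comment> \<open>Induction on the support, with additivity applied to the partition into
    \<open>{a}\<close>, \<open>A\<close> and the rest, which contains \<open>m\<close>.
    Complementing a set changes its vector only by \<open>1\<close>.\<close>
  have ind_case: "f (span2 1 (ind A)) = span2 1 (L (ind A))" if "A \<noteq> {}" "m \<notin> A" for A
    using finite[of A] that
  proof (induction A rule: finite_ne_induct)
    case (singleton a)
    then show ?case using single by auto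
  next
    case (insert a A)
    have "m \<notin> insert a A" using insert by auto
    then have part: "{a} \<noteq> {}" "A \<noteq> {}" "- insert a A \<noteq> {}" "{a} \<inter> A = {}" "{a} \<inter> - insert a A = {}"
      "A \<inter> - insert a A = {}" "{a} \<union> A \<union> - insert a A = UNIV"
      using insert by auto
    note code = span2_ind_compl_code[OF part]
    have "a \<noteq> m" using insert by auto
    have ne: "- {a} \<noteq> {}" "- A \<noteq> {}" "- {a} \<noteq> - A" using insert by auto
    have "f (span2 1 (ind (- {a}) + ind (- A))) = span2 1 (L (ind {a}) + L (ind A))"
    proof (rule code_emb_codesA_additive[OF emb f_A code(1)])
      show "f (span2 1 (ind (- {a}))) = span2 1 (L (ind {a}))"
        using single[OF \<open>a \<noteq> m\<close>] by (simp add: ind_compl span2_one_add_one)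
      show "f (span2 1 (ind (- A))) = span2 1 (L (ind A))"
        using insert by (simp add: ind_compl span2_one_add_one)
    qed (use ne in \<open>auto simp: span2_def\<close>)
    moreover have "ind (insert a A) = ind {a} + ind A"
      using insert by (auto simp: vec_eq_iff)
    ultimately show ?case by (simp add: code(2) add)
  qed
  have all: "f (span2 1 x) = span2 1 (L x)" if "x \<noteq> 0" "x \<noteq> 1" for x
  proof (cases "x $ m = 1")
    case True
    define A where "A = {i. x $ i = 0}"
    have "m \<notin> A" using True by (simp add: A_def)
    moreover have "A \<noteq> {}" using vec_bit_neq_oneE[OF that(2)] by (auto simp: A_def)
    moreover have "x = ind A + 1" by (auto simp: A_def vec_eq_iff)
    ultimately show ?thesis using ind_case[of A] by (simp add: span2_one_add_one add L1)
  next
    case False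
    have "{i. x $ i = 1} \<noteq> {}" using vec_bit_neq_zeroE[OF that(1)] by auto
    then show ?thesis using ind_case[of "{i. x $ i = 1}"] False by (simp add: ind_support)
  qed
  have ker: "x = 0" if "L x = 0" for x
  proof (rule ccontr)
    assume "x \<noteq> 0"
    moreover have "x \<noteq> 1" using that L1 by auto
    ultimately have "span2 1 (L x) \<in> codesA"
      using all span2_one_in_codesA f_A by (metis image_subset_iff)
    \<comment> \<open>If \<open>L x = 0\<close>, the image code would collapse to the line through
      \<open>1\<close>.\<close>
    then have "{0, 1} \<in> (Grass 2 :: (bit ^ 'n) set set)"
      using that by (simp add: codesA_iff span2_def insert_commute)
    then obtain y where "y \<in> {0, 1 :: bit ^ 'n}" "y \<noteq> 0" "y \<noteq> 1"
      using Grass2_obtain[of "{0, 1 :: bit ^ 'n}" 1] by auto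
    then show False by auto
  qed
  have "inj L"
  proof (rule injI)
    fix x y assume "L x = L y"
    then have "L (x + y) = 0" by (simp add: add)
    then show "x = y" using ker by fastforce
  qed
  moreover have "f X = L ` X" if "X \<in> codesA" for X
  proof -
    obtain x where x: "x \<noteq> 0" "x \<noteq> 1" "X = span2 1 x" using codesA_obtain[OF \<open>X \<in> codesA\<close>] .
    then show ?thesis using all[OF x(1,2)] by (simp add: image_span2[of L, OF add] L1)
  qed
  ultimately show thesis using that add by metis
qed

text \<open>Composing with the inverse of the automorphism induced by \<open>L\<close> reduces to
  the case where all codes through \<open>1\<close> are fixed.\<close>

lemma aut_or_h_if_codesA_into_codesA:
  fixes f :: "(bit ^ 'n::finite) set \<Rightarrow> (bit ^ 'n) set"
  assumes card: "CARD('n) \<ge> 4" and emb: "code_emb f" and f_A: "f ` codesA \<subseteq> codesA"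
  shows "aut_or_h m f"
proof -
  obtain L :: "bit ^ 'n \<Rightarrow> bit ^ 'n" where add: "\<And>x y. L (x + y) = L x + L y" and inj: "inj L"
    and L: "\<And>X. X \<in> codesA \<Longrightarrow> f X = L ` X"
    using code_emb_codesA_linear[OF emb f_A] by metis
  let ?g = "inv_into (Grass 2) (image L)"
  have aut: "graph_aut (image L) grassmann_graph" using graph_aut_image[OF add inj] .
  then have aut': "graph_aut ?g grassmann_graph" using graph_aut_inv_into by fastforce
  have "(?g \<circ> f) X = X" if X: "X \<in> codesA" for X
  proof -
    have "inj_on (image L) (Grass 2)" using aut by (simp add: graph_iso_def bij_betw_def)
    moreover have "X \<in> Grass 2" using X by (simp add: codesA_iff)
    ultimately show ?thesis using L[OF X] by simp
  qed
  then have "aut_or_h m (?g \<circ> f)"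
    using aut_or_h_if_fixing_codesA[OF card code_emb_comp[OF emb aut']] by metis
  then show ?thesis using aut_or_h_comp[OF emb aut'] by simp
qed

lemma aut_or_h_if_codesA_into_star:
  fixes f :: "(bit ^ 'n::finite) set \<Rightarrow> (bit ^ 'n) set"
  assumes card: "CARD('n) \<ge> 4" and emb: "code_emb f"
    and q: "q \<noteq> 0" "\<And>X. X \<in> codesA \<Longrightarrow> q \<in> f X"
  shows "aut_or_h m f"
proof -
  obtain i where i: "q $ i = 1" using vec_bit_neq_zeroE[OF q(1)] .
  \<comment> \<open>A linear involution taking \<open>q\<close> to \<open>1\<close>: since
    \<open>q\<close> is 1 at \<open>i\<close>, the added direction \<open>q + 1\<close> vanishes
    there.\<close>
  define T where "T x = x + x $ i *s (q + 1)" for x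
  have add: "T (x + y) = T x + T y" for x y
    unfolding T_def vector_add_component vector_sadd_rdistrib by (simp only: ac_simps)
  have "T (T x) = x" for x
    using i by (cases "x $ i") (simp_all add: T_def ac_simps)
  then have "inj T" by (metis injI)
  then have aut: "graph_aut (image T) grassmann_graph" using graph_aut_image[of T, OF add] by blast
  have "T q = 1" using i by (simp add: T_def)
  have "(image T \<circ> f) X \<in> codesA" if X: "X \<in> codesA" for X
  proof -
    have "f X \<in> Grass 2" using code_embD(2)[OF emb] X codesA_subset_codes by auto
    then have "T ` f X \<in> Grass 2" using image_in_Grass2[OF add \<open>inj T\<close>] by blast
    moreover have "1 \<in> T ` f X" using q(2)[OF X] \<open>T q = 1\<close> by force
    ultimately show ?thesis by (simp add: codesA_iff)
  qed
  then have "aut_or_h m (image T \<circ> f)"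
    using aut_or_h_if_codesA_into_codesA[OF card code_emb_comp[OF emb aut]] by blast
  then show ?thesis using aut_or_h_comp[OF emb aut] by blast
qed

section \<open>Cliques and duality\<close>

text \<open>Without a common vector there are \<open>X\<close>, \<open>Y\<close> meeting in
  \<open>p\<close> and \<open>Z\<close> avoiding \<open>p\<close>. A member avoiding
  \<open>p\<close> meets \<open>X\<close> and \<open>Y\<close> in different vectors, and a member
  through \<open>p\<close> meets \<open>Z\<close> in a second vector; both lie in
  \<open>X + Y\<close>.\<close>

lemma clique_star_or_top:
  fixes K :: "(bit ^ 'n::finite) set set"
  assumes K: "K \<subseteq> Grass 2" "K \<noteq> {}"
    and clique: "\<And>X Y. X \<in> K \<Longrightarrow> Y \<in> K \<Longrightarrow> X \<noteq> Y \<Longrightarrow> \<exists>w. w \<noteq> 0 \<and> w \<in> X \<and> w \<in> Y"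
  obtains (star) q where "q \<noteq> 0" "\<And>X. X \<in> K \<Longrightarrow> q \<in> X"
    | (top) p u v where "\<And>X. X \<in> K \<Longrightarrow> X \<subseteq> vec.span {p, u, v}"
proof (cases "\<exists>q. q \<noteq> 0 \<and> (\<forall>X \<in> K. q \<in> X)")
  case False
  obtain X where X: "X \<in> K" using K(2) by auto
  obtain a b where "a \<noteq> 0" "X = span2 a b"
    using K(1) X by (auto simp: Grass2_iff subset_iff)
  then obtain Y where Y: "Y \<in> K" "X \<noteq> Y" using False by (auto simp: span2_def)
  then obtain p where p: "p \<noteq> 0" "p \<in> X" "p \<in> Y" using clique[OF X Y] by auto
  obtain Z where Z: "Z \<in> K" "p \<notin> Z" using False p(1) by auto
  have triangle: "\<exists>s t. s \<in> X \<and> t \<in> Y \<and> s \<noteq> p \<and> t \<noteq> p \<and> s \<noteq> 0 \<and> t \<noteq> 0 \<and> T = span2 s t"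
    if T: "T \<in> K" "p \<notin> T" for T
  proof -
    have "T \<noteq> X" "T \<noteq> Y" using T(2) p by auto
    then obtain s t where s: "s \<noteq> 0" "s \<in> T" "s \<in> X" and t: "t \<noteq> 0" "t \<in> T" "t \<in> Y"
      using clique[OF T(1) X] clique[OF T(1) Y(1)] by auto
    have "s \<noteq> p" "t \<noteq> p" using s t T(2) by auto
    have "X \<in> Grass 2" "Y \<in> Grass 2" using X Y(1) K(1) by auto
    then have "s \<noteq> t"
      using Grass2_cong[of X Y p s] p s t Y(2) \<open>s \<noteq> p\<close> by auto
    then have "T = span2 s t" using K(1) T(1) s t by (intro Grass2_eq_span2) auto
    then show ?thesis using s t \<open>s \<noteq> p\<close> \<open>t \<noteq> p\<close> by metis
  qed
  obtain u v where uv: "u \<in> X" "v \<in> Y" "u \<noteq> p" "v \<noteq> p" "u \<noteq> 0" "v \<noteq> 0" "Z = span2 u v"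
    using triangle[OF Z] by metis
  let ?U = "vec.span {p, u, v}"
  have XG: "X \<in> Grass 2" and YG: "Y \<in> Grass 2" using X Y K(1) by auto
  have gen: "p \<in> ?U" "u \<in> ?U" "v \<in> ?U" by (simp_all add: vec.span_base)
  have span2_sub: "span2 s t \<subseteq> ?U" if "s \<in> ?U" "t \<in> ?U" for s t
    using that by (auto simp: span2_def vec.span_zero vec.span_add)
  have "X = span2 p u" "Y = span2 p v"
    using Grass2_eq_span2[OF XG p(2) uv(1) p(1) uv(5)] Grass2_eq_span2[OF YG p(3) uv(2) p(1) uv(6)] uv(3,4)
    by metis+
  then have sub: "X \<subseteq> ?U" "Y \<subseteq> ?U" "Z \<subseteq> ?U"
    using span2_sub[OF gen(1,2)] span2_sub[OF gen(1,3)] span2_sub[OF gen(2,3)] uv(7) by simp_all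
  have "T \<subseteq> ?U" if T: "T \<in> K" for T
  proof (cases "p \<in> T")
    case True
    then have "T \<noteq> Z" using Z by auto
    then obtain z where z: "z \<noteq> 0" "z \<in> T" "z \<in> Z" using clique[OF T Z(1)] by auto
    then have "T = span2 p z" using K(1) T True p(1) Z(2) by (intro Grass2_eq_span2) auto
    moreover have "z \<in> ?U" using sub(3) z(3) by (rule subsetD)
    ultimately show ?thesis using span2_sub[OF gen(1)] by simp
  next
    case False
    then obtain s t where st: "s \<in> X" "t \<in> Y" "T = span2 s t" using triangle[OF T] by metis
    show ?thesis unfolding st(3)
      using subsetD[OF sub(1) st(1)] subsetD[OF sub(2) st(2)] by (rule span2_sub)
  qed
  then show thesis by (rule top)
qed (use star in blast)

lemma card_span3_le: "card (vec.span {p, u, v :: bit ^ 'n::finite}) \<le> 8"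
proof -
  let ?S = "span2 u v \<union> (+) p ` span2 u v"
  have card2: "card (span2 u v) \<le> 4" unfolding span2_def by (simp add: card_insert_if)
  have "vec.span {p, u, v} \<subseteq> ?S"
  proof
    fix x assume "x \<in> vec.span {p, u, v}"
    then obtain k where k: "x - k *s p \<in> span2 u v"
      by (auto simp: vec.span_insert[of p] span_pair_eq_span2)
    show "x \<in> ?S"
    proof (cases k)
      case zero
      then show ?thesis using k by simp
    next
      case one
      then have "x = p + (x - p)" "x - p \<in> span2 u v" using k by simp_all
      then show ?thesis by blast
    qed
  qed
  then have "card (vec.span {p, u, v}) \<le> card ?S" by (intro card_mono) auto
  also have "\<dots> \<le> card (span2 u v) + card ((+) p ` span2 u v)" by (rule card_Un_le)
  also have "\<dots> \<le> 8" using card2 card_image_le[of "span2 u v" "(+) p"] by simp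
  finally show ?thesis .
qed

text \<open>Distinct members of \<^term>\<open>K\<close> share no ordered pair of distinct nonzero vectors, and each has 6 of them.\<close>

lemma card_Grass2_le_if_subset:
  fixes K :: "(bit ^ 'n::finite) set set"
  assumes K: "K \<subseteq> Grass 2" "\<And>X. X \<in> K \<Longrightarrow> X \<subseteq> U" and U: "card U \<le> 8" "0 \<in> U"
  shows "6 * card K \<le> 49"
proof -
  define P where "P X = (X - {0}) \<times> (X - {0}) - Id_on (X - {0})" for X :: "(bit ^ 'n) set"
  have card_P: "6 \<le> card (P X)" if "X \<in> K" for X
  proof -
    obtain a b where ab: "a \<noteq> 0" "b \<noteq> 0" "a \<noteq> b" "X = span2 a b"
      using K(1) \<open>X \<in> K\<close> by (auto simp: Grass2_iff subset_iff)
    then have "X - {0} = {a, b, a + b}" by (auto simp: span2_def)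
    then have card3: "card (X - {0}) = 3" using ab by (simp add: card_insert_if)
    have "Id_on (X - {0}) = (\<lambda>x. (x, x)) ` (X - {0})" by auto
    then have "card (Id_on (X - {0})) \<le> 3" using card_image_le[of "X - {0}" "\<lambda>x. (x, x)"] card3 by simp
    moreover have "card ((X - {0}) \<times> (X - {0})) - card (Id_on (X - {0})) \<le> card (P X)"
      unfolding P_def by (rule diff_card_le_card_Diff) simp
    ultimately show ?thesis using card3 by (simp add: card_cartesian_product)
  qed
  have disj: "P X \<inter> P Y = {}" if XY: "X \<in> K" "Y \<in> K" "X \<noteq> Y" for X Y
  proof (rule ccontr)
    assume "P X \<inter> P Y \<noteq> {}"
    then obtain x y where "x \<noteq> y" "x \<noteq> 0" "y \<noteq> 0" "x \<in> X" "y \<in> X" "x \<in> Y" "y \<in> Y"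
      by (auto simp: P_def Id_on_iff)
    then show False using Grass2_cong[of X Y x y] XY K(1) by auto
  qed
  have "6 * card K \<le> (\<Sum>X\<in>K. card (P X))"
    using sum_bounded_below[of K 6 "\<lambda>X. card (P X)"] card_P by simp
  also have "\<dots> = card (\<Union>X\<in>K. P X)"
    by (rule card_UN_disjoint[symmetric]) (use disj in auto)
  \<comment> \<open>Counting the diagonal too gives 49 instead of the sharp 42, hence at most 8
    planes, which is enough to exclude \<open>n \<ge> 5\<close>.\<close>
  also have "\<dots> \<le> card ((U - {0}) \<times> (U - {0}))"
    using K(2) by (intro card_mono) (auto simp: P_def)
  also have "\<dots> = card (U - {0}) * card (U - {0})" by (rule card_cartesian_product)
  also have "card (U - {0}) \<le> 7" using U by (simp add: card_Diff_singleton)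
  then have "card (U - {0}) * card (U - {0}) \<le> 7 * 7" by (rule mult_le_mono) (use U in \<open>simp add: card_Diff_singleton\<close>)
  finally show ?thesis by simp
qed

text \<open>The planes through \<open>1\<close> cover V, and each contributes at most two vectors
  besides 0 and \<open>1\<close>.\<close>

lemma card_codesA: "2 ^ CARD('n) \<le> 2 + 2 * card (codesA :: (bit ^ 'n::finite) set set)"
proof -
  let ?A = "codesA :: (bit ^ 'n) set set"
  have le2: "card (X - {0, 1}) \<le> 2" if X: "X \<in> ?A" for X
  proof -
    obtain x where "X = span2 1 x" using codesA_obtain[OF X] by metis
    then have "X - {0, 1} \<subseteq> {x, 1 + x}" by (auto simp: span2_def)
    then have "card (X - {0, 1}) \<le> card {x, 1 + x}" by (intro card_mono) auto
    then show ?thesis using card_insert_le_m1[of 2 "{1 + x}" x] by simp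
  qed
  have "x \<in> {0, 1} \<union> (\<Union>X\<in>?A. X - {0, 1})" for x :: "bit ^ 'n"
  proof (cases "x = 0 \<or> x = 1")
    case False
    then have "span2 1 x \<in> ?A" "x \<in> span2 1 x - {0, 1}"
      using span2_one_in_codesA by (auto simp: span2_def)
    then show ?thesis by blast
  qed auto
  then have "card (UNIV :: (bit ^ 'n) set) \<le> card ({0, 1} \<union> (\<Union>X\<in>?A. X - {0, 1}))"
    by (intro card_mono) auto
  also have "\<dots> \<le> card {0, 1 :: bit ^ 'n} + card (\<Union>X\<in>?A. X - {0, 1})" by (rule card_Un_le)
  also have "card {0, 1 :: bit ^ 'n} = 2" by simp
  also have "card (\<Union>X\<in>?A. X - {0, 1}) \<le> (\<Sum>X\<in>?A. card (X - {0, 1}))"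
    by (rule card_UN_le) simp
  also have "\<dots> \<le> (\<Sum>X\<in>?A. 2)" using le2 by (rule sum_mono)
  finally show ?thesis by simp
qed

section \<open>The orthogonality duality on planes in dimension four\<close>

definition dot :: "bit ^ 'n::finite \<Rightarrow> bit ^ 'n \<Rightarrow> bit" where
  "dot x y = (\<Sum>i\<in>UNIV. x $ i * y $ i)"

lemma dot_add: "dot (x + y) z = dot x z + dot y z" "dot z (x + y) = dot z x + dot z y"
  by (simp_all add: dot_def algebra_simps sum.distrib)

lemma dot_zero [simp]: "dot 0 x = 0" "dot x 0 = 0"
  by (simp_all add: dot_def)

lemma dot_scale: "dot x (c *s y) = c * dot x y"
  by (cases c) (auto simp: dot_def)

lemma dot_commute: "dot x y = dot y x"
  by (simp add: dot_def mult.commute)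

lemma dot_ind: "dot x (ind {i}) = x $ i"
  by (simp add: dot_def if_distrib cong: if_cong)

text \<open>Pigeonhole: three bits cannot separate at least 16 vectors, and the sum of two vectors
  not separated is orthogonal to all three.\<close>

lemma ex_orthogonal:
  fixes p u v :: "bit ^ 'n::finite"
  assumes "CARD('n) \<ge> 4"
  obtains w where "w \<noteq> 0" "dot p w = 0" "dot u w = 0" "dot v w = 0"
proof -
  define F where "F w = (dot p w, dot u w, dot v w)" for w
  have "card (range F) \<le> CARD(bit \<times> bit \<times> bit)" by (intro card_mono) auto
  also have "\<dots> = 8" by simp
  also have "8 < (2 :: nat) ^ 4" by simp
  also have "(2 :: nat) ^ 4 \<le> 2 ^ CARD('n)" using assms by (intro power_increasing) auto
  finally have "card (range F) < card (UNIV :: (bit ^ 'n) set)" by simp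
  then have "\<not> inj F" by (rule pigeonhole)
  then obtain x y where xy: "x \<noteq> y" "F x = F y" by (auto simp: inj_def)
  then show thesis using that[of "x + y"] by (auto simp: F_def dot_add)
qed

text \<open>A coordinate in the support of \<open>a\<close> but not of \<open>b\<close> gives a unit
  vector. Otherwise the support of \<open>a\<close> is strictly inside that of \<open>b\<close>, and
  adding a unit vector at a coordinate of the difference corrects the product with
  \<open>b\<close>.\<close>

lemma ex_dual_vector:
  fixes a b :: "bit ^ 'n::finite"
  assumes "a \<noteq> 0" "a \<noteq> b"
  obtains s where "dot a s = 1" "dot b s = 0"
proof (cases "\<exists>i. a $ i = 1 \<and> b $ i = 0")
  case True
  then show thesis using that dot_ind by metis
next
  case False
  obtain i where i: "a $ i = 1" using vec_bit_neq_zeroE[OF assms(1)] .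
  then have bi: "b $ i = 1" using i False by (metis bit_not_zero_iff)
  obtain j where "a $ j \<noteq> b $ j" using assms(2) by (auto simp: vec_eq_iff)
  then have "a $ j = 0" "b $ j = 1" using False by (metis bit_not_zero_iff)+
  then show thesis using that[of "ind {i} + ind {j}"] i bi by (simp add: dot_add dot_ind)
qed

definition perp :: "(bit ^ 'n::finite) set \<Rightarrow> (bit ^ 'n) set" where
  "perp X = {y. \<forall>x \<in> X. dot x y = 0}"

lemma perp_span2: "perp (span2 a b) = {y. dot a y = 0 \<and> dot b y = 0}"
  by (auto simp: perp_def span2_def dot_add)

lemma perp_in_Grass2:
  fixes X :: "(bit ^ 'n::finite) set"
  assumes card: "CARD('n) = 4" and X: "X \<in> Grass 2"
  shows "perp X \<in> Grass 2"
proof -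
  obtain a b where ab: "a \<noteq> 0" "b \<noteq> 0" "a \<noteq> b" "X = span2 a b"
    using X by (auto simp: Grass2_iff)
  obtain s where s: "dot a s = 1" "dot b s = 0" using ex_dual_vector ab by metis
  obtain t where t: "dot b t = 1" "dot a t = 0" using ex_dual_vector[of b a] ab by metis
  define K where "K = perp X"
  have K: "y \<in> K \<longleftrightarrow> dot a y = 0 \<and> dot b y = 0" for y
    by (simp add: K_def ab(4) perp_span2)
  \<comment> \<open>The vectors \<open>s\<close>, \<open>t\<close> are dual to \<open>a\<close>,
    \<open>b\<close> and span a complement of \<open>K\<close>; comparing cardinalities,
    \<open>16 = 4 * card K\<close>.\<close>
  have "bij_betw (\<lambda>(k, c, d). k + (c *s s + d *s t)) (K \<times> UNIV \<times> UNIV) UNIV"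
  proof (rule bij_betwI[where g = "\<lambda>y. (y + (dot a y *s s + dot b y *s t), dot a y, dot b y)"])
    show "(\<lambda>y. (y + (dot a y *s s + dot b y *s t), dot a y, dot b y)) \<in> UNIV \<rightarrow> K \<times> UNIV \<times> UNIV"
      by (auto simp: K dot_add dot_scale s t)
  qed (auto simp: K dot_add dot_scale s t add.assoc)
  then have "card (K \<times> (UNIV :: bit set) \<times> (UNIV :: bit set)) = card (UNIV :: (bit ^ 'n) set)"
    by (rule bij_betw_same_card)
  then have card_K: "card K = 4" using card by (simp add: card_cartesian_product)
  have "0 \<in> K" by (simp add: K)
  then have "card (K - {0}) = 3" using card_K by simp
  then obtain x y z where xyz: "K - {0} = {x, y, z}" "x \<noteq> y"
    by (auto simp: card_3_iff)
  then have x: "x \<in> K" "x \<noteq> 0" and y: "y \<in> K" "y \<noteq> 0" by auto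
  have "span2 x y \<subseteq> K" using x y by (auto simp: span2_def K dot_add)
  moreover have "card (span2 x y) = 4"
    using x y xyz(2) by (simp add: span2_def card_insert_if)
  ultimately have "span2 x y = K" using card_K by (intro card_subset_eq) auto
  then show ?thesis using span2_in_Grass[of x y] x y xyz(2) by (simp add: K_def)
qed

lemma perp_perp:
  fixes X :: "(bit ^ 'n::finite) set"
  assumes card: "CARD('n) = 4" and X: "X \<in> Grass 2"
  shows "perp (perp X) = X"
proof -
  have "X \<subseteq> perp (perp X)" by (auto simp: perp_def dot_commute)
  then show ?thesis
    using Grass2_subset_eq[OF X] perp_in_Grass2[OF card] X by metis
qed

text \<open>Planes sharing a vector lie in a common space spanned by three vectors, and a nonzero
  vector orthogonal to it lies in both duals. The converse follows because \<open>perp\<close> is an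
  involution on planes.\<close>

lemma graph_aut_perp:
  assumes card: "CARD('n::finite) = 4"
  shows "graph_aut (perp :: (bit ^ 'n) set \<Rightarrow> _) grassmann_graph"
proof -
  have "bij_betw perp (Grass 2) (Grass 2 :: (bit ^ 'n) set set)"
    by (rule bij_betwI[where g = perp]) (auto simp: perp_in_Grass2 perp_perp card)
  moreover have edge: "{perp X, perp Y} \<in> edges grassmann_graph"
    if e: "{X, Y} \<in> edges grassmann_graph" for X Y :: "(bit ^ 'n) set"
  proof -
    obtain v where XY: "X \<in> Grass 2" "Y \<in> Grass 2" "X \<noteq> Y" and v: "v \<noteq> 0" "v \<in> X" "v \<in> Y"
      using e by (auto simp: edge_grassmann_iff)
    obtain a where a: "X = span2 v a" using Grass2_obtain[OF XY(1) v(2,1)] by metis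
    obtain b where b: "Y = span2 v b" using Grass2_obtain[OF XY(2) v(3,1)] by metis
    obtain w where "w \<noteq> 0" "dot v w = 0" "dot a w = 0" "dot b w = 0"
      using ex_orthogonal[of v a b] card by auto
    then have "w \<noteq> 0" "w \<in> perp X" "w \<in> perp Y" by (simp_all add: a b perp_span2)
    moreover have "perp X \<noteq> perp Y" using XY perp_perp[OF card] by metis
    ultimately show ?thesis using XY perp_in_Grass2[OF card] by (auto simp: edge_grassmann_iff)
  qed
  moreover have "{X, Y} \<in> edges grassmann_graph"
    if "X \<in> Grass 2" "Y \<in> Grass 2" "{perp X, perp Y} \<in> edges grassmann_graph" for X Y :: "(bit ^ 'n) set"
    using edge[OF that(3)] perp_perp[OF card] that by simp
  ultimately show ?thesis unfolding graph_iso_def verts_grassmann by blast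
qed

section \<open>The clique of images of codes through the all-ones vector, and the conclusion\<close>

lemma code_emb_aut_or_h:
  fixes f :: "(bit ^ 'n::finite) set \<Rightarrow> (bit ^ 'n) set"
  assumes card: "CARD('n) \<ge> 4" and emb: "code_emb f"
  shows "aut_or_h m f"
proof -
  note emb_facts = code_embD[OF emb]
  have sub: "f ` codesA \<subseteq> Grass 2" using emb_facts(2) codesA_subset_codes by auto
  have "(2 :: nat) ^ 4 \<le> 2 ^ CARD('n)" using card by (intro power_increasing) auto
  also have "\<dots> \<le> 2 + 2 * card (codesA :: (bit ^ 'n) set set)" by (rule card_codesA)
  finally have ne: "f ` codesA \<noteq> {}" by auto
  have clique: "\<exists>w. w \<noteq> 0 \<and> w \<in> X \<and> w \<in> Y"
    if XY: "X \<in> f ` codesA" "Y \<in> f ` codesA" "X \<noteq> Y" for X Y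
  proof -
    obtain X' Y' where "X' \<in> codesA" "Y' \<in> codesA" "X = f X'" "Y = f Y'" using XY(1,2) by blast
    moreover from this have "X' \<noteq> Y'" using XY(3) by auto
    moreover have "Z \<in> codes \<and> 1 \<in> Z" if "Z \<in> codesA" for Z :: "(bit ^ 'n) set"
      using that codesA_subset_codes by (auto simp: codesA_iff)
    ultimately show ?thesis
      using emb_facts(3)[of X' Y' 1] by simp
  qed
  show ?thesis
  proof (rule clique_star_or_top[OF sub ne])
    show "\<exists>w. w \<noteq> 0 \<and> w \<in> X \<and> w \<in> Y" if "X \<in> f ` codesA" "Y \<in> f ` codesA" "X \<noteq> Y" for X Y
      using clique[OF that] .
  next
    fix q assume "q \<noteq> 0" and "\<And>X. X \<in> f ` codesA \<Longrightarrow> q \<in> X"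
    then show ?thesis using aut_or_h_if_codesA_into_star[OF card emb, of q] by blast
  next
    fix p u v assume top: "\<And>X. X \<in> f ` codesA \<Longrightarrow> X \<subseteq> vec.span {p, u, v}"
    have "6 * card (f ` codesA) \<le> 49"
      using card_Grass2_le_if_subset[OF sub _ card_span3_le vec.span_zero] top by blast
    moreover have "card (f ` codesA) = card (codesA :: (bit ^ 'n) set set)"
      using emb_facts(1) codesA_subset_codes by (intro card_image) (rule inj_on_subset)
    \<comment> \<open>At most 8 codes contain \<open>1\<close>, so the number of vectors is at most
      \<open>2 + 2 * 8 = 18\<close>, below 32.\<close>
    ultimately have "(2 :: nat) ^ CARD('n) < 2 ^ 5" using card_codesA[where 'n = 'n] by simp
    then have "CARD('n) < 5" by (rule power_less_imp_less_exp[rotated]) simp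
    then have card4: "CARD('n) = 4" using card by simp
    obtain w where w: "w \<noteq> 0" "dot p w = 0" "dot u w = 0" "dot v w = 0"
      using ex_orthogonal[OF card] by metis
    \<comment> \<open>All images lie in the hyperplane orthogonal to \<open>w\<close>, so their
      duals share \<open>w\<close> and the common-vector case applies to
      \<open>perp \<circ> f\<close>.\<close>
    have "vec.span {p, u, v} \<subseteq> {x. dot x w = 0}"
      using w by (intro vec.span_minimal) (auto simp: vec_bit_subspace_iff dot_add)
    then have "w \<in> (perp \<circ> f) X" if "X \<in> codesA" for X
      using top[of "f X"] that by (auto simp: perp_def)
    then have "aut_or_h m (perp \<circ> f)"
      using aut_or_h_if_codesA_into_star[OF card code_emb_comp[OF emb graph_aut_perp[OF card4]]] w(1)
      by blast
    then show ?thesis using aut_or_h_comp[OF emb graph_aut_perp[OF card4]] by blast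
  qed
qed

theorem theorem4:
  fixes m :: "'n::finite"
    and G' :: "(bit ^ 'n) set graph"
    and f :: "(bit ^ 'n) set \<Rightarrow> (bit ^ 'n) set"
  assumes "CARD('n) \<ge> 4"
    and "subgraph G' grassmann_graph"
    and "graph_iso f code_graph G'"
    and "\<not> (\<exists>g. graph_aut g grassmann_graph \<and> (\<forall>X \<in> codes. g X = f X))"
  shows "\<exists>g. graph_aut g grassmann_graph \<and> (\<forall>X \<in> codes. f X = g (h_map m X))"
proof -
  have "aut_or_h m f"
    using code_emb_aut_or_h[OF assms(1) code_emb_if_graph_iso[OF assms(2,3)]] .
  then show ?thesis using assms(4) unfolding aut_or_h_def by metis
qed

end
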